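(* Let $p$ be a fixed prime. Then there exists a countable non-abelian simple group $M$, which is not torsion free, such that every finite non-trivial subgroup of $M$ is cyclic of order $p$. *)

theory Defs
  imports "HOL-Algebra.Elementary_Groups" "HOL-Computational_Algebra.Primes"
    "HOL-Library.Countable_Set"
begin

(* The library locale simple_group requires order G > 1. Since order G is the
   cardinality as a natural number, which is 0 for infinite carriers, that locale
   only covers finite groups; the definition below also covers infinite ones. *)
definition is_simple_group :: "('a, 'b) monoid_scheme \<Rightarrow> bool" where
  "is_simple_group G \<longleftrightarrow> group G \<and> \<not> trivial_group G \<and>
     (\<forall>N. N \<lhd> G \<longrightarrow> N = {\<one>\<^bsub>G\<^esub>} \<or> N = carrier G)"

definition torsion_free_group :: "('a, 'b) monoid_scheme \<Rightarrow> bool" where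
  "torsion_free_group G \<longleftrightarrow> group G \<and>
     (\<forall>x \<in> carrier G. \<forall>n::nat. n > 0 \<longrightarrow> x [^]\<^bsub>G\<^esub> n = \<one>\<^bsub>G\<^esub> \<longrightarrow> x = \<one>\<^bsub>G\<^esub>)"

end

theory Submission
  imports Defs "HOL-Algebra.Multiplicative_Group"
begin

text \<open>
  The proof combines a criterion for simplicity with a way to make elements conjugate.

  \<^bold>\<open>A criterion for simplicity.\<close> Suppose that in a group every finite non-trivial subgroup has
  order \<open>p\<close>. Then every element has order \<open>1\<close>, \<open>p\<close> or \<open>\<infinity>\<close>. If moreover any two elements of equal order
  are conjugate, then a normal subgroup \<open>N\<close> is determined by which of these orders occur in it. Let
  \<open>x\<close> have order \<open>p\<close> and let \<open>t\<close> be such that \<open>t\<close>, \<open>t x\<close> and \<open>x (t x t\<inverse>)\<close> have infinite order. If \<open>N\<close>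
  contains an element of infinite order, it contains \<open>t\<close> and \<open>t x\<close>, hence \<open>x\<close>; if it contains an
  element of order \<open>p\<close>, it contains \<open>x (t x t\<inverse>)\<close>. In both cases \<open>N\<close> is the whole group. This is
  \<open>simple_of_equal_orders_conjugate\<close>.

  \<^bold>\<open>Making elements conjugate.\<close> If \<open>a\<close> and \<open>b\<close> have equal order in a countable group \<open>G\<close>, the HNN
  extension \<open>\<langle>G, t | t a t\<inverse> = b\<rangle>\<close> contains \<open>G\<close>, makes \<open>a\<close> and \<open>b\<close> conjugate, and each of its
  finite subgroups is conjugate to a subgroup of \<open>G\<close>; \<open>hnn_extension\<close> records the consequence that
  no new cardinalities of finite subgroups arise. Starting from the cyclic group of order
  \<open>p\<close>, first with \<open>a = b = 1\<close> to obtain a \<open>t\<close> as above, and then running through all pairs, the union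
  of the chain of extensions satisfies the criterion.

  The HNN extension is realised as a concrete group rather than by generators and relations. Elements
  of equal order become conjugate by a permutation \<open>f\<close> of \<open>G \<times> \<nat>\<close>, on which \<open>G\<close> acts by translation,
  because \<open>a\<close> and \<open>b\<close> both have infinitely many cycles there, all of the same length. Let \<open>G\<close> and the
  induced permutation \<open>q\<close> act on the set \<open>X\<close> of subsets of \<open>G \<times> \<nat>\<close>, and form the semidirect product
  of the free group on \<open>X\<close> with the permutations of \<open>X\<close>. Its element \<open>t = x\<^sub>0 q\<close>, where \<open>x\<^sub>0\<close> is a
  \<open>b\<close>-cycle, satisfies \<open>t a = b t\<close>. The stabilisers of \<open>x\<^sub>0\<close> and \<open>q\<inverse> x\<^sub>0\<close> in \<open>G\<close> are generated by \<open>b\<close>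
  and \<open>a\<close>, so that a cancellation in the free group component of a product of elements of \<open>G\<close> and
  powers of \<open>t\<close> is always the consequence of the relation \<open>t a = b t\<close>. The subgroup generated by \<open>G\<close>
  and \<open>t\<close> therefore consists of reduced products (\<open>hnn\<close>).

  Finite subgroups are controlled by the free group component. If \<open>(w, \<pi>)\<close> has finite order and
  \<open>w \<noteq> 1\<close>, then \<open>w\<close> is not cyclically reduced: it has the form \<open>y u \<pi>(y)\<inverse>\<close>. In a finite subgroup all
  non-trivial words begin with the same letter \<open>y\<close>, and conjugation by an element with word \<open>y\<close>
  shortens all of them. Repeating this moves the subgroup into \<open>G\<close>. This is the fixed point
  theorem for finite groups acting on trees, for the Cayley tree of the free group.
\<close>

section \<open>Free groups extended by permutations of the basis\<close>

text \<open>A name for inverse permutations, since the notation \<open>inv\<close> is used for inverses in groups.\<close>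
abbreviation perm_inv :: "('x \<Rightarrow> 'x) \<Rightarrow> 'x \<Rightarrow> 'x" where
  "perm_inv \<equiv> inv_into UNIV"

text \<open>The letter \<open>(x, True)\<close> stands for the basis element \<open>x\<close>, and \<open>(x, False)\<close> for its inverse.\<close>
type_synonym 'x letter = "'x \<times> bool"

definition flip :: "'x letter \<Rightarrow> 'x letter" where
  "flip l = (fst l, \<not> snd l)"

definition reduced :: "'x letter list \<Rightarrow> bool" where
  "reduced w \<longleftrightarrow> successively (\<lambda>l m. m \<noteq> flip l) w"

fun push :: "'x letter \<Rightarrow> 'x letter list \<Rightarrow> 'x letter list" where
  "push l [] = [l]"
| "push l (m # v) = (if m = flip l then v else l # m # v)"

text \<open>Letters are multiplied from the left one at a time, cancelling where possible. On reduced words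
  this is the group operation of the free group.\<close>
definition word_mult :: "'x letter list \<Rightarrow> 'x letter list \<Rightarrow> 'x letter list" (infixl "\<odot>" 70) where
  "w \<odot> v = foldr push w v"

definition word_inv :: "'x letter list \<Rightarrow> 'x letter list" where
  "word_inv w = rev (map flip w)"

definition relabel :: "('x \<Rightarrow> 'y) \<Rightarrow> 'x letter \<Rightarrow> 'y letter" where
  "relabel \<pi> l = (\<pi> (fst l), snd l)"

lemma flip_flip [simp]: "flip (flip l) = l"
  by (simp add: flip_def)

lemma flip_neq [simp]: "flip l \<noteq> l" "l \<noteq> flip l"
  by (auto simp: flip_def prod_eq_iff)

lemma flip_eq_iff [simp]: "flip l = flip m \<longleftrightarrow> l = m"
  by (auto simp: flip_def prod_eq_iff)

lemma flip_relabel: "flip (relabel \<pi> l) = relabel \<pi> (flip l)"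
  by (simp add: flip_def relabel_def)

lemma relabel_eq_iff [simp]: "inj \<pi> \<Longrightarrow> relabel \<pi> l = relabel \<pi> m \<longleftrightarrow> l = m"
  by (auto simp: relabel_def prod_eq_iff inj_eq)

lemma relabel_relabel [simp]: "relabel \<pi> (relabel \<rho> l) = relabel (\<pi> \<circ> \<rho>) l"
  by (simp add: relabel_def)

lemma relabel_comp [simp]: "relabel \<pi> \<circ> relabel \<rho> = relabel (\<pi> \<circ> \<rho>)"
  by (simp add: relabel_def fun_eq_iff)

lemma relabel_id [simp]: "relabel id = id"
  by (simp add: relabel_def fun_eq_iff)

lemma reduced_Nil [simp]: "reduced []"
  by (simp add: reduced_def)

lemma reduced_single [simp]: "reduced [l]"
  by (simp add: reduced_def)

lemma reduced_Cons: "reduced (l # v) \<longleftrightarrow> reduced v \<and> (v \<noteq> [] \<longrightarrow> hd v \<noteq> flip l)"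
  by (cases v) (auto simp: reduced_def)

lemma reduced_append:
  "reduced (w @ v) \<longleftrightarrow> reduced w \<and> reduced v \<and> (w \<noteq> [] \<longrightarrow> v \<noteq> [] \<longrightarrow> hd v \<noteq> flip (last w))"
  by (auto simp: reduced_def successively_append_iff)

lemma reduced_map_relabel: "inj \<pi> \<Longrightarrow> reduced (map (relabel \<pi>) w) \<longleftrightarrow> reduced w"
  by (simp add: reduced_def successively_map flip_relabel)

lemma reduced_word_inv: "reduced w \<Longrightarrow> reduced (word_inv w)"
  by (induction w) (auto simp: word_inv_def reduced_append reduced_Cons last_rev hd_map)

lemma reduced_push: "reduced v \<Longrightarrow> reduced (push l v)"
  by (cases v) (auto simp: reduced_Cons)

lemma push_push_flip: "reduced v \<Longrightarrow> push l (push (flip l) v) = v"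
  by (cases v; cases "tl v") (auto simp: reduced_Cons)

lemma push_flip_push: "reduced v \<Longrightarrow> push (flip l) (push l v) = v"
  using push_push_flip[of v "flip l"] by simp

lemma Nil_word_mult [simp]: "[] \<odot> v = v"
  and Cons_word_mult [simp]: "(l # w) \<odot> v = push l (w \<odot> v)"
  and append_word_mult: "(u @ w) \<odot> v = u \<odot> (w \<odot> v)"
  by (simp_all add: word_mult_def)

lemma reduced_word_mult: "reduced v \<Longrightarrow> reduced (w \<odot> v)"
  by (induction w) (auto simp: reduced_push)

lemma push_word_mult: "reduced v \<Longrightarrow> push l w \<odot> v = push l (w \<odot> v)"
  by (cases w) (auto simp: push_push_flip reduced_word_mult)

lemma word_mult_assoc: "reduced u \<Longrightarrow> (w \<odot> v) \<odot> u = w \<odot> (v \<odot> u)"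
  by (induction w) (auto simp: push_word_mult)

lemma word_mult_eq_append: "reduced (w @ v) \<Longrightarrow> w \<odot> v = w @ v"
proof (induction w)
  case (Cons l w)
  then show ?case by (cases "w @ v") (auto simp: reduced_Cons)
qed simp

lemma mult_Nil: "reduced w \<Longrightarrow> w \<odot> [] = w"
  using word_mult_eq_append[of w "[]"] by simp

lemma word_inv_mult_cancel: "reduced v \<Longrightarrow> word_inv w \<odot> (w \<odot> v) = v"
  by (induction w arbitrary: v)
     (auto simp: word_inv_def append_word_mult push_flip_push reduced_word_mult)

lemma word_inv_mult: "reduced w \<Longrightarrow> word_inv w \<odot> w = []"
  using word_inv_mult_cancel[of "[]" w] by (simp add: mult_Nil)

lemma map_push: "inj \<pi> \<Longrightarrow> map (relabel \<pi>) (push l v) = push (relabel \<pi> l) (map (relabel \<pi>) v)"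
  by (cases v) (auto simp: flip_relabel)

lemma map_word_mult:
  "inj \<pi> \<Longrightarrow> map (relabel \<pi>) (w \<odot> v) = map (relabel \<pi>) w \<odot> map (relabel \<pi>) v"
  by (induction w) (auto simp: map_push)

text \<open>The semidirect product of the free group on the type \<^typ>\<open>'x\<close> with the group of all permutations
  of \<^typ>\<open>'x\<close>, which acts on words letter by letter and so preserves their length.\<close>
definition free_sym :: "('x letter list \<times> ('x \<Rightarrow> 'x)) monoid" where
  "free_sym = \<lparr>carrier = {(w, \<pi>). reduced w \<and> bij \<pi>},
     monoid.mult = (\<lambda>(w, \<pi>) (v, \<rho>). (w \<odot> map (relabel \<pi>) v, \<pi> \<circ> \<rho>)), one = ([], id)\<rparr>"

lemma carrier_free_sym: "(w, \<pi>) \<in> carrier free_sym \<longleftrightarrow> reduced w \<and> bij \<pi>"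
  and mult_free_sym: "(w, \<pi>) \<otimes>\<^bsub>free_sym\<^esub> (v, \<rho>) = (w \<odot> map (relabel \<pi>) v, \<pi> \<circ> \<rho>)"
  and one_free_sym: "\<one>\<^bsub>free_sym\<^esub> = ([], id)"
  by (simp_all add: free_sym_def)

lemma free_sym_inverse:
  assumes "reduced w" "bij \<pi>"
  shows "(map (relabel (perm_inv \<pi>)) (word_inv w), perm_inv \<pi>) \<in> carrier free_sym"
    and "(map (relabel (perm_inv \<pi>)) (word_inv w), perm_inv \<pi>) \<otimes>\<^bsub>free_sym\<^esub> (w, \<pi>) = \<one>\<^bsub>free_sym\<^esub>"
  using assms
  by (simp_all add: carrier_free_sym mult_free_sym one_free_sym bij_imp_bij_inv bij_is_inj
      reduced_map_relabel reduced_word_inv map_word_mult[symmetric] word_inv_mult)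

interpretation free_sym: group "free_sym :: ('x letter list \<times> ('x \<Rightarrow> 'x)) monoid"
proof (rule groupI)
  fix x y z :: "'x letter list \<times> ('x \<Rightarrow> 'x)"
  assume "x \<in> carrier free_sym" "y \<in> carrier free_sym" "z \<in> carrier free_sym"
  then show "x \<otimes>\<^bsub>free_sym\<^esub> y \<otimes>\<^bsub>free_sym\<^esub> z = x \<otimes>\<^bsub>free_sym\<^esub> (y \<otimes>\<^bsub>free_sym\<^esub> z)"
    by (cases x; cases y; cases z)
       (simp add: carrier_free_sym mult_free_sym map_word_mult word_mult_assoc bij_is_inj
         reduced_map_relabel bij_comp o_assoc)
next
  fix x :: "'x letter list \<times> ('x \<Rightarrow> 'x)"
  assume "x \<in> carrier free_sym"
  then show "\<exists>y \<in> carrier free_sym. y \<otimes>\<^bsub>free_sym\<^esub> x = \<one>\<^bsub>free_sym\<^esub>"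
    using free_sym_inverse by (cases x) (fastforce simp: carrier_free_sym)
qed (auto simp: free_sym_def reduced_word_mult bij_comp reduced_map_relabel bij_is_inj)

lemma inv_free_sym:
  assumes "(w, \<pi>) \<in> carrier free_sym"
  shows "inv\<^bsub>free_sym\<^esub> (w, \<pi>) = (map (relabel (perm_inv \<pi>)) (word_inv w), perm_inv \<pi>)"
  using assms free_sym_inverse free_sym.inv_equality by (fastforce simp: carrier_free_sym)

text \<open>Unless the last letter of \<open>w\<close> cancels against the first letter of \<open>\<pi>(w)\<close>, the powers of
  \<open>(w, \<pi>)\<close> have the words \<open>w \<pi>(w) \<pi>\<^sup>2(w) \<dots>\<close> without any cancellation, and these are not empty.\<close>
lemma torsion_last:
  assumes "(w, \<pi>) \<in> carrier free_sym" "w \<noteq> []"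
    and "(w, \<pi>) [^]\<^bsub>free_sym\<^esub> (n::nat) = \<one>\<^bsub>free_sym\<^esub>" "n > 0"
  shows "last w = flip (relabel \<pi> (hd w))"
proof (rule ccontr)
  assume ne: "last w \<noteq> flip (relabel \<pi> (hd w))"
  have wr: "reduced w" "inj \<pi>"
    using assms by (auto simp: carrier_free_sym bij_is_inj)
  have "fst ((w, \<pi>) [^]\<^bsub>free_sym\<^esub> (Suc m)) \<noteq> [] \<and> hd (fst ((w, \<pi>) [^]\<^bsub>free_sym\<^esub> (Suc m))) = hd w" for m
  proof (induction m)
    case 0
    then show ?case using assms by simp
  next
    case (Suc m)
    obtain v \<rho> where v: "(w, \<pi>) [^]\<^bsub>free_sym\<^esub> (Suc m) = (v, \<rho>)" by fastforce
    have "(v, \<rho>) \<in> carrier free_sym"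
      using v assms(1) free_sym.nat_pow_closed by metis
    then have "reduced v" by (simp add: carrier_free_sym)
    moreover have "v \<noteq> []" "hd v = hd w" using Suc v by auto
    ultimately have "reduced (w @ map (relabel \<pi>) v)"
      using wr ne by (auto simp: reduced_append reduced_map_relabel hd_map)
    moreover have "(w, \<pi>) [^]\<^bsub>free_sym\<^esub> (Suc (Suc m)) = (w, \<pi>) \<otimes>\<^bsub>free_sym\<^esub> (v, \<rho>)"
      unfolding v[symmetric] using assms(1) free_sym.nat_pow_Suc2 by blast
    ultimately show ?case using assms(2)
      by (simp add: mult_free_sym word_mult_eq_append del: free_sym.nat_pow_Suc nat_pow_Suc)
  qed
  from this[of "n - 1"] show False
    using assms(3,4) by (simp add: one_free_sym)
qed

lemma finite_subgroup_torsion: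
  assumes E: "subgroup E free_sym" "finite E" and x: "x \<in> E"
  obtains n :: nat where "n > 0" "x [^]\<^bsub>free_sym\<^esub> n = \<one>\<^bsub>free_sym\<^esub>"
proof
  interpret E: group "free_sym\<lparr>carrier := E\<rparr>"
    using E(1) free_sym.subgroup_imp_group by blast
  have "x [^]\<^bsub>free_sym\<lparr>carrier := E\<rparr>\<^esub> order (free_sym\<lparr>carrier := E\<rparr>) = \<one>\<^bsub>free_sym\<lparr>carrier := E\<rparr>\<^esub>"
    using x by (intro E.pow_order_eq_1) simp
  then show "x [^]\<^bsub>free_sym\<^esub> card E = \<one>\<^bsub>free_sym\<^esub>"
    by (simp add: order_def nat_pow_def)
  show "card E > 0"
    using E(2) x by (auto simp: card_gt_0_iff)
qed

lemma finite_subgroup_last: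
  assumes E: "subgroup E free_sym" "finite E" and w: "(w, \<pi>) \<in> E" "w \<noteq> []"
  shows "last w = flip (relabel \<pi> (hd w))"
proof -
  obtain n :: nat where "n > 0" "(w, \<pi>) [^]\<^bsub>free_sym\<^esub> n = \<one>\<^bsub>free_sym\<^esub>"
    using finite_subgroup_torsion[OF E w(1)] by blast
  moreover have "(w, \<pi>) \<in> carrier free_sym"
    using subgroup.subset[OF E(1)] w(1) by blast
  ultimately show ?thesis using torsion_last w(2) by blast
qed

text \<open>If two words began with different letters \<open>y\<close> and \<open>z\<close>, then the word of the product
  \<open>(w, \<pi>)\<inverse> (v, \<rho>)\<close> would arise without cancellation. Its first and last letters are determined by
  \<open>y\<close> and \<open>z\<close>, and \<open>torsion_last\<close>, applied to both elements and to this product, forces \<open>y = z\<close>.\<close>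
lemma finite_subgroup_same_hd:
  assumes E: "subgroup E free_sym" "finite E"
    and w: "(w, \<pi>) \<in> E" "w \<noteq> []" and v: "(v, \<rho>) \<in> E" "v \<noteq> []"
  shows "hd v = hd w"
proof (rule ccontr)
  assume ne: "hd v \<noteq> hd w"
  note last = finite_subgroup_last[OF E]
  have car: "(w, \<pi>) \<in> carrier free_sym" "(v, \<rho>) \<in> carrier free_sym"
    using w(1) v(1) subgroup.subset[OF E(1)] by auto
  then have red: "reduced w" "bij \<pi>" "reduced v" "bij \<rho>"
    by (auto simp: carrier_free_sym)
  let ?\<pi> = "perm_inv \<pi>"
  let ?u = "word_inv w @ v"
  have "last (word_inv w) = flip (hd w)"
    using w(2) by (simp add: word_inv_def last_rev hd_map)
  then have red_u: "reduced ?u"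
    using ne w(2) v(2) red by (auto simp: reduced_append reduced_word_inv)
  have "inv\<^bsub>free_sym\<^esub> (w, \<pi>) \<otimes>\<^bsub>free_sym\<^esub> (v, \<rho>) = (map (relabel ?\<pi>) ?u, ?\<pi> \<circ> \<rho>)"
    using car red red_u
    by (simp add: inv_free_sym mult_free_sym map_word_mult[symmetric] bij_imp_bij_inv bij_is_inj word_mult_eq_append
        del: map_append)
  then have "(map (relabel ?\<pi>) ?u, ?\<pi> \<circ> \<rho>) \<in> E"
    using w(1) v(1) E(1) by (metis subgroup.m_closed subgroup.m_inv_closed)
  from last[OF this] v(2)
  have "relabel ?\<pi> (last v) = flip (relabel (?\<pi> \<circ> \<rho>) (relabel ?\<pi> (hd ?u)))"
    by (simp add: last_map hd_map del: map_append relabel_relabel)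
  also have "hd ?u = relabel \<pi> (hd w)"
    using last[OF w] w(2) by (simp add: word_inv_def hd_append hd_rev last_map)
  also have "relabel (?\<pi> \<circ> \<rho>) (relabel ?\<pi> (relabel \<pi> (hd w))) = relabel ?\<pi> (relabel \<rho> (hd w))"
    using red by (simp add: bij_is_inj o_assoc[symmetric])
  finally have "last v = flip (relabel \<rho> (hd w))"
    using red by (simp add: flip_relabel bij_imp_bij_inv bij_is_inj del: relabel_relabel)
  then show False
    using last[OF v] ne red by (simp add: bij_is_inj)
qed

text \<open>Let \<open>y\<close> be the common first letter. A non-empty word \<open>v\<close> in the subgroup has the form
  \<open>y u \<rho>(y)\<inverse>\<close>, and conjugation removes both ends. When the word is empty, the element fixes \<open>y\<close>:
  otherwise its product with \<open>(w, \<pi>)\<close> would begin with a different letter. Conjugation then leaves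
  the word empty.\<close>
lemma conj_shortens:
  assumes E: "subgroup E free_sym" "finite E"
    and w: "(w, \<pi>) \<in> E" "w \<noteq> []" and h: "([hd w], \<sigma>) \<in> carrier free_sym" and k: "k \<in> E"
  shows "length (fst (inv\<^bsub>free_sym\<^esub> ([hd w], \<sigma>) \<otimes>\<^bsub>free_sym\<^esub> k \<otimes>\<^bsub>free_sym\<^esub> ([hd w], \<sigma>))) \<le> length (fst k) - 1"
proof -
  obtain v \<rho> where k_eq: "k = (v, \<rho>)" by fastforce
  let ?y = "hd w" and ?\<sigma> = "perm_inv \<sigma>"
  note last = finite_subgroup_last[OF E]
  have "(w, \<pi>) \<in> carrier free_sym" "(v, \<rho>) \<in> carrier free_sym"
    using subgroup.subset[OF E(1)] w(1) k k_eq by blast+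
  then have red: "reduced w" "inj \<pi>" "reduced v" "inj \<rho>" "inj \<sigma>" "inj ?\<sigma>"
    using h by (auto simp: carrier_free_sym bij_is_inj bij_imp_bij_inv)
  have conj: "fst (inv\<^bsub>free_sym\<^esub> ([?y], \<sigma>) \<otimes>\<^bsub>free_sym\<^esub> k \<otimes>\<^bsub>free_sym\<^esub> ([?y], \<sigma>))
      = map (relabel ?\<sigma>) (push (flip ?y) v \<odot> [relabel \<rho> ?y])"
    unfolding k_eq using h red
    by (simp add: inv_free_sym mult_free_sym word_inv_def map_push map_word_mult o_assoc)
  show ?thesis
  proof (cases "v = []")
    case True
    have "(w, \<pi>) \<otimes>\<^bsub>free_sym\<^esub> ([], \<rho>) = (w, \<pi> \<circ> \<rho>)"
      "([], \<rho>) \<otimes>\<^bsub>free_sym\<^esub> (w, \<pi>) = (map (relabel \<rho>) w, \<rho> \<circ> \<pi>)"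
      using red by (simp_all add: mult_free_sym mult_Nil)
    then have "(map (relabel \<rho>) w, \<rho> \<circ> \<pi>) \<in> E"
      using w(1) k True unfolding k_eq by (metis E(1) subgroup.m_closed)
    from finite_subgroup_same_hd[OF E w this] w(2) have "relabel \<rho> ?y = ?y"
      by (simp add: hd_map)
    then show ?thesis unfolding conj True by simp
  next
    case False
    have hd: "hd v = ?y"
      using finite_subgroup_same_hd[OF E w] k False unfolding k_eq by blast
    then have last_v: "last v = flip (relabel \<rho> ?y)"
      using last[of v \<rho>] k False unfolding k_eq by simp
    obtain u where v: "v = ?y # u" using hd False by (cases v) auto
    have "u \<noteq> []"
      using last_v v by (auto simp: flip_def relabel_def prod_eq_iff)
    then obtain u' where u: "u = u' @ [flip (relabel \<rho> ?y)]"
      using last_v unfolding v by (cases u rule: rev_cases) auto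
    have eq: "push (flip ?y) v \<odot> [relabel \<rho> ?y] = u'"
      using red(3) unfolding v u by (simp add: append_word_mult mult_Nil reduced_append reduced_Cons)
    show ?thesis unfolding conj eq by (simp add: k_eq v u)
  qed
qed

lemma (in group) conj_mult:
  assumes "h \<in> carrier G" "x \<in> carrier G" "y \<in> carrier G"
  shows "(inv h \<otimes> x \<otimes> h) \<otimes> (inv h \<otimes> y \<otimes> h) = inv h \<otimes> (x \<otimes> y) \<otimes> h"
proof -
  have "h \<otimes> (inv h \<otimes> z) = z" if "z \<in> carrier G" for z
    using assms(1) that by (simp add: m_assoc[symmetric])
  then show ?thesis using assms by (simp add: m_assoc)
qed

text \<open>The induction takes place inside a subgroup \<open>N\<close> that contains, for each first letter \<open>l\<close> of one
  of its words, an element with the word \<open>l\<close>. The conjugating elements then lie in \<open>N\<close>.\<close>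
lemma finite_subgroup_conj_into_stabilizer:
  assumes N: "subgroup N free_sym"
    and prefix: "\<And>l w \<pi>. (l # w, \<pi>) \<in> N \<Longrightarrow> \<exists>\<sigma>. ([l], \<sigma>) \<in> N"
    and E: "subgroup E free_sym" "finite E" "E \<subseteq> N"
  shows "\<exists>h \<in> N. \<forall>k \<in> E. fst (inv\<^bsub>free_sym\<^esub> h \<otimes>\<^bsub>free_sym\<^esub> k \<otimes>\<^bsub>free_sym\<^esub> h) = []"
proof -
  interpret N: subgroup N free_sym by fact
  have "\<exists>h \<in> N. \<forall>k \<in> E. fst (inv\<^bsub>free_sym\<^esub> h \<otimes>\<^bsub>free_sym\<^esub> k \<otimes>\<^bsub>free_sym\<^esub> h) = []"
    if "subgroup E free_sym" "finite E" "E \<subseteq> N" "\<forall>k \<in> E. length (fst k) \<le> n" for E n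
    using that
  proof (induction n arbitrary: E)
    case 0
    then show ?case
      by (intro bexI[of _ "\<one>\<^bsub>free_sym\<^esub>"])
        (auto simp del: free_sym.inv_one simp: free_sym.inv_one subset_iff)
  next
    case (Suc n)
    note E = Suc.prems
    interpret E: subgroup E free_sym by fact
    show ?case
    proof (cases "\<forall>k \<in> E. fst k = []")
      case True
      with E(3) show ?thesis
        by (intro bexI[of _ "\<one>\<^bsub>free_sym\<^esub>"]) (auto simp: subset_iff)
    next
      case False
      then obtain w \<pi> where w: "(w, \<pi>) \<in> E" "w \<noteq> []" by force
      then have "(hd w # tl w, \<pi>) \<in> N" using E(3) by auto
      then obtain \<sigma> where h: "([hd w], \<sigma>) \<in> N" using prefix by blast
      let ?h = "([hd w], \<sigma>)"
      let ?c = "\<lambda>k. inv\<^bsub>free_sym\<^esub> ?h \<otimes>\<^bsub>free_sym\<^esub> k \<otimes>\<^bsub>free_sym\<^esub> ?h"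
      have hc: "?h \<in> carrier free_sym" using h by simp
      have "group_hom free_sym free_sym ?c"
      proof (unfold_locales, rule homI)
        fix x y :: "('a \<times> bool) list \<times> ('a \<Rightarrow> 'a)" assume xy: "x \<in> carrier free_sym" "y \<in> carrier free_sym"
        then show "?c (x \<otimes>\<^bsub>free_sym\<^esub> y) = ?c x \<otimes>\<^bsub>free_sym\<^esub> ?c y"
          using hc free_sym.conj_mult by metis
      qed (use hc in auto)
      then have "subgroup (?c ` E) free_sym"
        using E(1) group_hom.subgroup_img_is_subgroup by blast
      moreover have "?c ` E \<subseteq> N" using h E(3) by auto
      moreover have "\<forall>k \<in> ?c ` E. length (fst k) \<le> n"
        using conj_shortens[OF E(1,2) w hc] E(4) by fastforce
      ultimately obtain h' where h': "h' \<in> N"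
        "\<forall>k \<in> ?c ` E. fst (inv\<^bsub>free_sym\<^esub> h' \<otimes>\<^bsub>free_sym\<^esub> k \<otimes>\<^bsub>free_sym\<^esub> h') = []"
        using Suc.IH[of "?c ` E"] E(2) by auto
      have "inv\<^bsub>free_sym\<^esub> (?h \<otimes>\<^bsub>free_sym\<^esub> h') \<otimes>\<^bsub>free_sym\<^esub> k \<otimes>\<^bsub>free_sym\<^esub> (?h \<otimes>\<^bsub>free_sym\<^esub> h')
          = inv\<^bsub>free_sym\<^esub> h' \<otimes>\<^bsub>free_sym\<^esub> ?c k \<otimes>\<^bsub>free_sym\<^esub> h'" if "k \<in> E" for k
        using that hc h'(1) by (simp add: free_sym.inv_mult_group free_sym.m_assoc)
      then show ?thesis
        using h h' by (intro bexI[of _ "?h \<otimes>\<^bsub>free_sym\<^esub> h'"]) auto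
    qed
  qed
  then show ?thesis
    using E by (metis finite_imageI Max_ge imageI)
qed

section \<open>Adjoining a stable letter\<close>

text \<open>A permutation group \<open>Gs\<close> and a permutation \<open>q\<close> of the basis, such that conjugation by \<open>q\<close> maps
  the stabiliser of \<open>q\<inverse>(x0)\<close> into \<open>Gs\<close>, and conjugation by \<open>q\<inverse>\<close> does the same with the stabiliser
  of \<open>x0\<close>. The two stabilisers are the associated subgroups of the HNN extension with the stable letter
  \<open>t = (x0, q)\<close>.\<close>
locale stable_letter =
  fixes Gs :: "('x \<Rightarrow> 'x) set" and q :: "'x \<Rightarrow> 'x" and x0 :: 'x
  assumes bij_Gs: "g \<in> Gs \<Longrightarrow> bij g" and id_Gs: "id \<in> Gs"
    and comp_Gs: "g \<in> Gs \<Longrightarrow> g' \<in> Gs \<Longrightarrow> g \<circ> g' \<in> Gs"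
    and inv_Gs: "g \<in> Gs \<Longrightarrow> perm_inv g \<in> Gs"
    and bij_q: "bij q"
    and pinch_pos: "g \<in> Gs \<Longrightarrow> g x0 = x0 \<Longrightarrow> perm_inv q \<circ> g \<circ> q \<in> Gs"
    and pinch_neg: "g \<in> Gs \<Longrightarrow> g (perm_inv q x0) = perm_inv q x0 \<Longrightarrow> q \<circ> g \<circ> perm_inv q \<in> Gs"
begin

text \<open>Uniform names for the data of \<open>t\<close> and \<open>t\<inverse>\<close>: the element \<open>stable \<epsilon>\<close> is \<open>t\<close> for \<open>\<epsilon> = True\<close> and
  \<open>t\<inverse> = (q\<inverse>(x0)\<inverse>, q\<inverse>)\<close> for \<open>\<epsilon> = False\<close>. The symmetry between the two signs halves the case
  distinctions below.\<close>
definition qs :: "bool \<Rightarrow> 'x \<Rightarrow> 'x" where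
  "qs \<epsilon> = (if \<epsilon> then q else perm_inv q)"

definition pt :: "bool \<Rightarrow> 'x" where
  "pt \<epsilon> = (if \<epsilon> then x0 else perm_inv q x0)"

definition stable :: "bool \<Rightarrow> 'x letter list \<times> ('x \<Rightarrow> 'x)" where
  "stable \<epsilon> = ([(pt \<epsilon>, \<epsilon>)], qs \<epsilon>)"

lemma bij_qs: "bij (qs \<epsilon>)"
  by (simp add: qs_def bij_q bij_imp_bij_inv)

lemma qs_qs: "qs \<epsilon> \<circ> qs (\<not> \<epsilon>) = id"
  using bij_q by (simp add: qs_def bij_is_inj bij_is_surj surj_iff[symmetric])

lemma qs_pt: "qs \<epsilon> (pt (\<not> \<epsilon>)) = pt \<epsilon>"
  using bij_q by (simp add: qs_def pt_def bij_is_surj surj_f_inv_f)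

lemma pinch: "g \<in> Gs \<Longrightarrow> g (pt \<epsilon>) = pt \<epsilon> \<Longrightarrow> qs (\<not> \<epsilon>) \<circ> g \<circ> qs \<epsilon> \<in> Gs"
  using pinch_pos pinch_neg by (simp add: qs_def pt_def split: if_splits)

text \<open>The reduced products \<open>g\<^sub>0 t\<^sup>\<plusminus> g\<^sub>1 \<dots> t\<^sup>\<plusminus> g\<^sub>n\<close>, those in which every factor \<open>t\<^sup>\<plusminus>\<close> adds a letter to
  the word. With this definition the properties of reduced products needed below hold by rule
  inversion, and the point to prove is that they form a subgroup.\<close>
inductive_set hnn :: "('x letter list \<times> ('x \<Rightarrow> 'x)) set" where
  base: "g \<in> Gs \<Longrightarrow> ([], g) \<in> hnn"
| step: "(w, \<pi>) \<in> hnn \<Longrightarrow> g \<in> Gs \<Longrightarrow> reduced (w @ [(\<pi> (pt \<epsilon>), \<epsilon>)])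
    \<Longrightarrow> (w @ [(\<pi> (pt \<epsilon>), \<epsilon>)], \<pi> \<circ> qs \<epsilon> \<circ> g) \<in> hnn"

lemma hnn_carrier_pair: "(w, \<pi>) \<in> hnn \<Longrightarrow> (w, \<pi>) \<in> carrier free_sym"
  by (induction rule: hnn.induct) (auto simp: carrier_free_sym bij_Gs bij_qs simp del: o_apply intro!: bij_comp)

lemma hnn_carrier: "x \<in> hnn \<Longrightarrow> x \<in> carrier free_sym"
  using hnn_carrier_pair by (cases x) simp

lemma hnn_mult_base:
  assumes "(w, \<pi>) \<in> hnn" "g \<in> Gs"
  shows "(w, \<pi> \<circ> g) \<in> hnn"
  using assms
proof cases
  case (step v \<rho> g' \<epsilon>)
  then show ?thesis
    using hnn.step[of v \<rho> "g' \<circ> g" \<epsilon>] assms(2) by (simp add: comp_Gs o_assoc)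
qed (simp add: hnn.base comp_Gs assms(2))

text \<open>This plays the role of Britton's lemma. If the new letter cancels, then the preceding factor is the
  opposite power of \<open>t\<close>, and the element \<open>g\<close> of \<open>Gs\<close> between the two fixes \<open>pt \<delta>\<close>. Then
  \<open>t\<^sup>\<minusplus> g t\<^sup>\<plusminus>\<close> lies in \<open>Gs\<close>, so the product remains a reduced one with one letter fewer.\<close>
lemma hnn_mult_stable:
  assumes x: "x \<in> hnn"
  shows "x \<otimes>\<^bsub>free_sym\<^esub> stable \<delta> \<in> hnn"
proof -
  obtain v \<rho> where v: "x = (v, \<rho>)" by fastforce
  note assms = x[unfolded v]
  have "(v, \<rho>) \<otimes>\<^bsub>free_sym\<^esub> stable \<delta> \<in> hnn"
    using assms
  proof cases
    case base
    then show ?thesis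
      using hnn.step[OF hnn.base[OF base(2)] id_Gs, of \<delta>]
      by (simp add: stable_def mult_free_sym relabel_def)
  next
    case (step w \<pi> g \<epsilon>)
    let ?l = "(\<pi> (pt \<epsilon>), \<epsilon>)" and ?\<pi> = "\<pi> \<circ> qs \<epsilon> \<circ> g"
    have red: "reduced (w @ [?l])" by fact
    show ?thesis
    proof (cases "reduced ((w @ [?l]) @ [(?\<pi> (pt \<delta>), \<delta>)])")
      case True
      have "(v, \<rho>) \<otimes>\<^bsub>free_sym\<^esub> stable \<delta> = ((w @ [?l]) @ [(?\<pi> (pt \<delta>), \<delta>)], ?\<pi> \<circ> qs \<delta>)"
        using word_mult_eq_append[OF True] step(1,2) by (simp add: stable_def mult_free_sym relabel_def)
      then show ?thesis
        using hnn.step[OF assms[unfolded step(1,2)] id_Gs True] by (simp add: o_def)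
    next
      case False
      have "bij \<pi>" "bij (qs \<epsilon>)"
        using hnn_carrier[OF step(3)] by (auto simp: carrier_free_sym bij_qs)
      have eq: "(?\<pi> (pt \<delta>), \<delta>) = flip ?l"
        using False red by (auto simp: reduced_append reduced_Cons)
      then have \<delta>: "\<delta> = (\<not> \<epsilon>)" and "?\<pi> (pt \<delta>) = \<pi> (pt \<epsilon>)" by (auto simp: flip_def)
      then have "qs \<epsilon> (g (pt \<delta>)) = qs \<epsilon> (pt \<delta>)"
        using \<open>bij \<pi>\<close> qs_pt by (simp add: bij_is_inj inj_eq)
      then have "g (pt \<delta>) = pt \<delta>"
        using \<open>bij (qs \<epsilon>)\<close> by (simp add: bij_is_inj inj_eq)
      from pinch[OF step(4) this] have "qs \<epsilon> \<circ> g \<circ> qs \<delta> \<in> Gs" by (simp add: \<delta>)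
      from hnn_mult_base[OF step(3) this] have "(w, ?\<pi> \<circ> qs \<delta>) \<in> hnn" by (simp add: o_assoc)
      moreover have "(w @ [?l]) \<odot> [(?\<pi> (pt \<delta>), \<delta>)] = w"
        unfolding eq using red by (simp add: append_word_mult reduced_append mult_Nil)
      then have "(v, \<rho>) \<otimes>\<^bsub>free_sym\<^esub> stable \<delta> = (w, ?\<pi> \<circ> qs \<delta>)"
        unfolding step(1,2) stable_def by (simp add: mult_free_sym relabel_def)
      ultimately show ?thesis by simp
    qed
  qed
  then show ?thesis by (simp add: v)
qed

lemma stable_carrier: "stable \<epsilon> \<in> carrier free_sym"
  by (simp add: stable_def carrier_free_sym bij_qs)

lemma step_eq_mult:
  assumes "reduced (w @ [(\<pi> (pt \<epsilon>), \<epsilon>)])"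
  shows "(w @ [(\<pi> (pt \<epsilon>), \<epsilon>)], \<pi> \<circ> qs \<epsilon> \<circ> g) = (w, \<pi>) \<otimes>\<^bsub>free_sym\<^esub> stable \<epsilon> \<otimes>\<^bsub>free_sym\<^esub> ([], g)"
  using assms word_mult_eq_append[OF assms]
  by (simp add: stable_def mult_free_sym relabel_def mult_Nil)

lemma hnn_mult:
  assumes "x \<in> hnn" "y \<in> hnn"
  shows "x \<otimes>\<^bsub>free_sym\<^esub> y \<in> hnn"
proof -
  obtain u \<tau> where y: "y = (u, \<tau>)" by fastforce
  have "(u, \<tau>) \<in> hnn" using assms(2) y by simp
  then show ?thesis unfolding y using assms(1)
  proof (induction rule: hnn.induct)
    case (base g)
    then show ?case
      using hnn_mult_base hnn_carrier by (cases x) (force simp: mult_free_sym mult_Nil carrier_free_sym)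
  next
    case (step w \<pi> g \<epsilon>)
    have c: "(w, \<pi>) \<in> carrier free_sym" "([], g) \<in> carrier free_sym" "x \<in> carrier free_sym"
      using hnn_carrier step.prems step.hyps hnn.base by auto
    obtain v \<rho> where v: "x \<otimes>\<^bsub>free_sym\<^esub> (w, \<pi>) \<otimes>\<^bsub>free_sym\<^esub> stable \<epsilon> = (v, \<rho>)" by fastforce
    have "(v, \<rho>) \<in> hnn" using hnn_mult_stable step.IH step.prems v by metis
    then have "(v, \<rho>) \<otimes>\<^bsub>free_sym\<^esub> ([], g) \<in> hnn"
      using hnn_mult_base[of v \<rho> g] step.hyps hnn_carrier[of "(v, \<rho>)"]
      by (simp add: mult_free_sym carrier_free_sym mult_Nil)
    then show ?case
      unfolding step_eq_mult[of w \<pi> \<epsilon> g, OF step.hyps(3)] v[symmetric]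
      using c stable_carrier by (simp add: free_sym.m_assoc)
  qed
qed

lemma stable_hnn: "stable \<epsilon> \<in> hnn"
  using hnn_mult_stable[OF hnn.base[OF id_Gs], of \<epsilon>] stable_carrier[of \<epsilon>]
  by (simp add: one_free_sym[symmetric])

lemma inv_stable: "inv\<^bsub>free_sym\<^esub> (stable \<epsilon>) = stable (\<not> \<epsilon>)"
proof (rule free_sym.inv_equality)
  show "stable (\<not> \<epsilon>) \<otimes>\<^bsub>free_sym\<^esub> stable \<epsilon> = \<one>\<^bsub>free_sym\<^esub>"
    using qs_qs[of "\<not> \<epsilon>"] qs_pt[of "\<not> \<epsilon>"]
    by (simp add: stable_def mult_free_sym one_free_sym relabel_def flip_def)
qed (simp_all add: stable_carrier)

lemma inv_base: "g \<in> Gs \<Longrightarrow> inv\<^bsub>free_sym\<^esub> ([], g) = ([], perm_inv g)"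
  using inv_free_sym[OF hnn_carrier[OF hnn.base]] by (simp add: word_inv_def)

lemma subgroup_hnn: "subgroup hnn free_sym"
proof (rule free_sym.subgroupI)
  have "(v, \<rho>) \<in> hnn \<Longrightarrow> inv\<^bsub>free_sym\<^esub> (v, \<rho>) \<in> hnn" for v \<rho>
  proof (induction rule: hnn.induct)
    case (base g)
    then show ?case by (simp add: inv_base hnn.base inv_Gs)
  next
    case (step w \<pi> g \<epsilon>)
    have c: "(w, \<pi>) \<in> carrier free_sym" "([], g) \<in> carrier free_sym"
      using hnn_carrier step.hyps hnn.base by auto
    then show ?case
      unfolding step_eq_mult[of w \<pi> \<epsilon> g, OF step.hyps(3)]
      using step stable_carrier
      by (simp add: free_sym.inv_mult_group inv_stable inv_base
          hnn_mult hnn.base inv_Gs stable_hnn)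
  qed
  then show "inv\<^bsub>free_sym\<^esub> x \<in> hnn" if "x \<in> hnn" for x
    using that by (cases x) simp
qed (use hnn_carrier hnn_mult hnn.base[OF id_Gs] in auto)

lemma hnn_empty_word: "([], g) \<in> hnn \<Longrightarrow> g \<in> Gs"
  by (erule hnn.cases) auto

lemma hnn_prefix:
  assumes "(l # w, \<pi>) \<in> hnn"
  shows "\<exists>\<sigma>. ([l], \<sigma>) \<in> hnn"
proof -
  have "(v, \<rho>) \<in> hnn \<Longrightarrow> v \<noteq> [] \<Longrightarrow> \<exists>\<sigma>. ([hd v], \<sigma>) \<in> hnn" for v \<rho>
  proof (induction rule: hnn.induct)
    case (step w \<pi> g \<epsilon>)
    show ?case
    proof (cases "w = []")
      case True
      then show ?thesis using hnn.step[OF step.hyps] by auto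
    next
      case False
      then show ?thesis using step.IH by simp
    qed
  qed simp
  from this[OF assms] show ?thesis by simp
qed

text \<open>Every finite subgroup is conjugate to one of \<open>Gs\<close>: after conjugation all words are empty, and
  elements of \<open>hnn\<close> with an empty word belong to \<open>Gs\<close>.\<close>
lemma finite_subgroup_hnn_card:
  assumes E: "subgroup E free_sym" "finite E" "E \<subseteq> hnn"
  obtains F where "F \<subseteq> Gs" "card F = card E" "finite F" "id \<in> F"
    "\<And>g g'. g \<in> F \<Longrightarrow> g' \<in> F \<Longrightarrow> g \<circ> g' \<in> F" "\<And>g. g \<in> F \<Longrightarrow> perm_inv g \<in> F"
proof -
  interpret N: subgroup hnn free_sym by (rule subgroup_hnn)
  interpret E: subgroup E free_sym by fact
  have "\<exists>h \<in> hnn. \<forall>k \<in> E. fst (inv\<^bsub>free_sym\<^esub> h \<otimes>\<^bsub>free_sym\<^esub> k \<otimes>\<^bsub>free_sym\<^esub> h) = []"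
    using finite_subgroup_conj_into_stabilizer[OF subgroup_hnn _ E] hnn_prefix by metis
  then obtain h where h1: "h \<in> hnn"
    and h2: "\<forall>k \<in> E. fst (inv\<^bsub>free_sym\<^esub> h \<otimes>\<^bsub>free_sym\<^esub> k \<otimes>\<^bsub>free_sym\<^esub> h) = []" ..
  note h = h1 h2[rule_format]
  let ?c = "\<lambda>k. inv\<^bsub>free_sym\<^esub> h \<otimes>\<^bsub>free_sym\<^esub> k \<otimes>\<^bsub>free_sym\<^esub> h"
  have c: "?c k = ([], snd (?c k))" if "k \<in> E" for k
    using h(2)[OF that] by (simp add: prod_eq_iff)
  have c_mult: "?c k \<otimes>\<^bsub>free_sym\<^esub> ?c k' = ?c (k \<otimes>\<^bsub>free_sym\<^esub> k')" if "k \<in> E" "k' \<in> E" for k k'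
    using that h(1) by (simp add: free_sym.conj_mult)
  have Gs: "snd (?c k) \<in> Gs" if "k \<in> E" for k
  proof -
    have "?c k \<in> hnn" using that h(1) E(3) by auto
    then show ?thesis using c[OF that] hnn_empty_word by metis
  qed
  have comp: "snd (?c k) \<circ> snd (?c k') = snd (?c (k \<otimes>\<^bsub>free_sym\<^esub> k'))" if "k \<in> E" "k' \<in> E" for k k'
    using c_mult[OF that] c that by (metis mult_free_sym snd_conv)
  have one: "snd (?c \<one>\<^bsub>free_sym\<^esub>) = id"
  proof -
    have "?c \<one>\<^bsub>free_sym\<^esub> = \<one>\<^bsub>free_sym\<^esub>" using hnn_carrier[OF h(1)] by simp
    then show ?thesis by (simp only: one_free_sym snd_conv)
  qed
  define d where "d k = snd (?c k)" for k
  have d_comp: "d k \<circ> d k' = d (k \<otimes>\<^bsub>free_sym\<^esub> k')" if "k \<in> E" "k' \<in> E" for k k'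
    unfolding d_def by (rule comp[OF that])
  have d_one: "d \<one>\<^bsub>free_sym\<^esub> = id" unfolding d_def by (rule one)
  have d_inj: "inj_on d E"
  proof (rule inj_onI)
    fix k k' assume k: "k \<in> E" "k' \<in> E" "d k = d k'"
    then have "?c k = ?c k'" using c unfolding d_def by metis
    then show "k = k'" using k h(1) by simp
  qed
  show ?thesis
  proof
    show "d ` E \<subseteq> Gs" using Gs unfolding d_def by blast
    show "card (d ` E) = card E" using d_inj by (rule card_image)
    show "finite (d ` E)" using E(2) by simp
    show "id \<in> d ` E" using d_one E.one_closed by (metis imageI)
    show "g \<circ> g' \<in> d ` E" if "g \<in> d ` E" "g' \<in> d ` E" for g g'
      using that d_comp by auto
    show "perm_inv g \<in> d ` E" if g: "g \<in> d ` E" for g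
    proof -
      obtain k where k: "k \<in> E" "g = d k" using g by blast
      have "g \<circ> d (inv\<^bsub>free_sym\<^esub> k) = id" "d (inv\<^bsub>free_sym\<^esub> k) \<circ> g = id"
        using k d_one by (simp_all add: d_comp)
      then have "perm_inv g = d (inv\<^bsub>free_sym\<^esub> k)"
        by (rule inv_unique_comp)
      then show ?thesis using k by auto
    qed
  qed
qed

text \<open>By induction on the length \<open>n\<close> there are countably many reduced products of length \<open>n\<close>, since each
  arises from one of length \<open>n - 1\<close>, an element of \<open>Gs\<close> and a sign.\<close>
lemma countable_hnn:
  assumes "countable Gs"
  shows "countable hnn"
proof -
  let ?L = "\<lambda>n. {x \<in> hnn. length (fst x) = n}"
  have "countable (?L n)" for n
  proof (induction n)
    case 0
    have "?L 0 \<subseteq> (\<lambda>g. ([], g)) ` Gs"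
    proof
      fix x assume "x \<in> ?L 0"
      then obtain g where "x = ([], g)" "([], g) \<in> hnn" by (cases x) auto
      then show "x \<in> (\<lambda>g. ([], g)) ` Gs" using hnn_empty_word by blast
    qed
    from countable_subset[OF this countable_image[OF assms]] show ?case .
  next
    case (Suc n)
    let ?f = "\<lambda>((w, \<pi>), g, \<epsilon>). (w @ [(\<pi> (pt \<epsilon>), \<epsilon>)], \<pi> \<circ> qs \<epsilon> \<circ> g)"
    have "?L (Suc n) \<subseteq> ?f ` (?L n \<times> Gs \<times> UNIV)"
    proof
      fix x assume "x \<in> ?L (Suc n)"
      then obtain v \<rho> where x: "x = (v, \<rho>)" "(v, \<rho>) \<in> hnn" "length v = Suc n"
        by (cases x) auto
      from x(2) show "x \<in> ?f ` (?L n \<times> Gs \<times> UNIV)"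
      proof cases
        case base
        then show ?thesis using x(3) by simp
      next
        case (step w \<pi> g \<epsilon>)
        then show ?thesis
          using x by (intro image_eqI[of _ _ "((w, \<pi>), g, \<epsilon>)"]) auto
      qed
    qed
    moreover have "countable (?L n \<times> Gs \<times> (UNIV :: bool set))"
      using Suc assms by (intro countable_SIGMA) auto
    ultimately show ?case
      by (rule countable_subset[OF _ countable_image])
  qed
  then have "countable (\<Union>n. ?L n)" by (intro countable_UN) auto
  then show ?thesis by (rule countable_subset[rotated]) auto
qed

text \<open>The word of \<open>t g\<close> is a single letter, so its first and last letter have the same sign,
  whereas \<open>torsion_last\<close> demands opposite signs.\<close>
lemma stable_base_infinite_order:
  assumes "g \<in> Gs" "n > 0"
  shows "(stable True \<otimes>\<^bsub>free_sym\<^esub> ([], g)) [^]\<^bsub>free_sym\<^esub> (n::nat) \<noteq> \<one>\<^bsub>free_sym\<^esub>"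
proof
  have eq: "stable True \<otimes>\<^bsub>free_sym\<^esub> ([], g) = ([(x0, True)], q \<circ> g)"
    by (simp add: stable_def mult_free_sym pt_def qs_def)
  assume "(stable True \<otimes>\<^bsub>free_sym\<^esub> ([], g)) [^]\<^bsub>free_sym\<^esub> n = \<one>\<^bsub>free_sym\<^esub>"
  from torsion_last[OF _ _ this[unfolded eq]] show False
    using assms by (auto simp: carrier_free_sym bij_Gs bij_q bij_comp flip_def relabel_def)
qed

text \<open>If \<open>g\<close> lies in neither associated subgroup, the word of \<open>g t g t\<inverse>\<close> has exactly two letters, and
  \<open>torsion_last\<close> could only hold if \<open>g\<close> fixed \<open>x0\<close>.\<close>
lemma base_conj_infinite_order:
  assumes g: "g \<in> Gs" "g x0 \<noteq> x0" "g (perm_inv q x0) \<noteq> perm_inv q x0" and "n > 0"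
  shows "(([], g) \<otimes>\<^bsub>free_sym\<^esub> (stable True \<otimes>\<^bsub>free_sym\<^esub> ([], g) \<otimes>\<^bsub>free_sym\<^esub> inv\<^bsub>free_sym\<^esub> stable True))
    [^]\<^bsub>free_sym\<^esub> (n::nat) \<noteq> \<one>\<^bsub>free_sym\<^esub>"
proof
  let ?x = "([], g) \<otimes>\<^bsub>free_sym\<^esub> (stable True \<otimes>\<^bsub>free_sym\<^esub> ([], g) \<otimes>\<^bsub>free_sym\<^esub> inv\<^bsub>free_sym\<^esub> stable True)"
  let ?w = "[(g x0, True), (g (q (g (perm_inv q x0))), False)]" and ?\<pi> = "g \<circ> q \<circ> g \<circ> perm_inv q"
  have b: "bij g" "bij q" "bij (perm_inv q)" by (simp_all add: bij_Gs bij_q bij_imp_bij_inv g)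
  have "q (g (perm_inv q x0)) \<noteq> q (perm_inv q x0)"
    using g(3) b by (simp add: bij_is_inj inj_eq)
  then have ne: "q (g (perm_inv q x0)) \<noteq> x0"
    using b by (simp add: bij_is_surj surj_f_inv_f)
  have eq: "?x = (?w, ?\<pi>)"
    using ne b by (simp add: inv_stable) (simp add: stable_def mult_free_sym pt_def qs_def relabel_def flip_def bij_is_inj inj_eq o_assoc)
  assume "?x [^]\<^bsub>free_sym\<^esub> n = \<one>\<^bsub>free_sym\<^esub>"
  from torsion_last[OF _ _ this[unfolded eq]]
  have "g (q (g (perm_inv q x0))) = g (q (g (perm_inv q (g x0))))"
    using b ne \<open>n > 0\<close> by (auto simp: carrier_free_sym reduced_Cons bij_comp flip_def relabel_def bij_is_inj inj_eq)
  then show False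
    using b g(2) by (simp add: bij_is_inj inj_eq)
qed

end

section \<open>Conjugating elements of equal order\<close>

definition equal_order :: "('a, 'b) monoid_scheme \<Rightarrow> 'a \<Rightarrow> 'a \<Rightarrow> bool" where
  "equal_order G a b \<longleftrightarrow> (\<forall>n::nat. a [^]\<^bsub>G\<^esub> n = \<one>\<^bsub>G\<^esub> \<longleftrightarrow> b [^]\<^bsub>G\<^esub> n = \<one>\<^bsub>G\<^esub>)"

definition infinite_order :: "('a, 'b) monoid_scheme \<Rightarrow> 'a \<Rightarrow> bool" where
  "infinite_order G a \<longleftrightarrow> (\<forall>n::nat. n > 0 \<longrightarrow> a [^]\<^bsub>G\<^esub> n \<noteq> \<one>\<^bsub>G\<^esub>)"

lemma bij_betw_of_same_kernel:
  assumes "\<And>i j. f i = f j \<longleftrightarrow> g i = g j"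
  obtains h where "bij_betw h (range f) (range g)" "\<And>i. h (f i) = g i"
proof
  let ?h = "\<lambda>y. g (inv_into UNIV f y)"
  show h: "?h (f i) = g i" for i
    using assms[of "inv_into UNIV f (f i)" i] by (simp add: f_inv_into_f)
  show "bij_betw ?h (range f) (range g)"
    by (intro bij_betwI') (use assms h in auto)
qed

text \<open>The map \<open>(k, n) \<mapsto> (c\<^sup>k r\<^sub>n, m\<^sub>n)\<close>, where \<open>e n = (r\<^sub>n, m\<^sub>n)\<close> enumerates the pairs of a representative
  of a coset of \<open>\<langle>c\<rangle>\<close> and a natural number. The factor \<open>\<nat>\<close> makes the number of cosets countably
  infinite, and so independent of the index of \<open>\<langle>c\<rangle>\<close>.\<close>
lemma (in group) cyclic_cosets_enumeration:
  assumes "countable (carrier G)" "c \<in> carrier G"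
  obtains e :: "nat \<Rightarrow> 'a \<times> nat" where
    "\<And>n. fst (e n) \<in> carrier G"
    "\<And>x m. x \<in> carrier G \<Longrightarrow> \<exists>(k::int) n. (c [^] k \<otimes> fst (e n), snd (e n)) = (x, m)"
    "\<And>(k::int) (l::int) n m. (c [^] k \<otimes> fst (e n), snd (e n)) = (c [^] l \<otimes> fst (e m), snd (e m))
      \<Longrightarrow> n = m \<and> c [^] k = c [^] l"
proof -
  define R where "R x y \<longleftrightarrow> (\<exists>k::int. y = c [^] k \<otimes> x)" for x y
  define r where "r x = (SOME y. R x y)" for x
  have r_eq: "r (c [^] k \<otimes> x) = r x" if x: "x \<in> carrier G" for x and k :: int
  proof -
    have "R (c [^] k \<otimes> x) y \<longleftrightarrow> R x y" for y
    proof
      assume "R (c [^] k \<otimes> x) y"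
      then obtain l :: int where "y = c [^] l \<otimes> (c [^] k \<otimes> x)" unfolding R_def by blast
      then have "y = c [^] (l + k) \<otimes> x"
        using x assms(2) by (simp add: int_pow_mult m_assoc)
      then show "R x y" unfolding R_def by blast
    next
      assume "R x y"
      then obtain l :: int where "y = c [^] l \<otimes> x" unfolding R_def by blast
      then have "y = c [^] (l - k) \<otimes> (c [^] k \<otimes> x)"
        using x assms(2) by (simp add: m_assoc[symmetric] int_pow_mult[symmetric])
      then show "R (c [^] k \<otimes> x) y" unfolding R_def by blast
    qed
    then show ?thesis unfolding r_def by presburger
  qed
  have r: "\<exists>k::int. r x = c [^] k \<otimes> x" if "x \<in> carrier G" for x
  proof -
    have "R x (c [^] (0::int) \<otimes> x)" unfolding R_def by blast
    then have "R x (r x)" unfolding r_def by (rule someI)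
    then show ?thesis unfolding R_def .
  qed
  have r_car: "r x \<in> carrier G" if "x \<in> carrier G" for x
    using r[OF that] that assms(2) by auto
  have r_r: "r (r x) = r x" if "x \<in> carrier G" for x
    using r[OF that] r_eq[OF that] by auto
  let ?T = "r ` carrier G \<times> (UNIV :: nat set)"
  have T: "countable ?T" "infinite ?T"
    using assms(1) by (auto dest: finite_cartesian_productD2)
  let ?e = "from_nat_into ?T"
  have e: "?e n \<in> ?T" for n
    using T by (metis from_nat_into finite.emptyI)
  then have e_fst: "fst (?e n) \<in> r ` carrier G" for n
    by (metis mem_Times_iff)
  have e_car: "fst (?e n) \<in> carrier G" for n
    by (rule imageE[OF e_fst[of n]]) (simp add: r_car)
  have e_r: "r (fst (?e n)) = fst (?e n)" for n
    by (rule imageE[OF e_fst[of n]]) (simp add: r_r)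
  show ?thesis
  proof
    show "fst (?e n) \<in> carrier G" for n by (rule e_car)
    show "\<exists>(k::int) n. (c [^] k \<otimes> fst (?e n), snd (?e n)) = (x, m)" if x: "x \<in> carrier G" for x m
    proof -
      obtain k :: int where k: "r x = c [^] k \<otimes> x" using r[OF x] by blast
      have "(r x, m) \<in> ?T" using x by blast
      then obtain n where "?e n = (r x, m)"
        using T from_nat_into_surj by metis
      moreover have "c [^] (-k) \<otimes> r x = x"
        unfolding k using x assms(2) by (simp add: m_assoc[symmetric] int_pow_mult[symmetric])
      ultimately show ?thesis by (metis fst_conv snd_conv)
    qed
    show "n = m \<and> c [^] k = c [^] l"
      if eq: "(c [^] k \<otimes> fst (?e n), snd (?e n)) = (c [^] l \<otimes> fst (?e m), snd (?e m))" for k l :: int and n m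
    proof -
      have "r (c [^] k \<otimes> fst (?e n)) = r (c [^] l \<otimes> fst (?e m))" using eq by simp
      then have "fst (?e n) = fst (?e m)"
        using r_eq e_car e_r by metis
      then have "?e n = ?e m" using eq by (simp add: prod_eq_iff)
      then have "n = m"
        using T from_nat_into_inj_infinite by blast
      then show ?thesis using eq e_car assms(2) by simp
    qed
  qed
qed

lemma (in group) int_pow_eq_iff_of_nat_pow:
  assumes "a \<in> carrier G" "b \<in> carrier G" "equal_order G a b"
  shows "a [^] (k::int) = a [^] (l::int) \<longleftrightarrow> b [^] k = b [^] l"
proof -
  have one: "c [^] k = c [^] l \<longleftrightarrow> c [^] nat \<bar>k - l\<bar> = \<one>" if c: "c \<in> carrier G" for c
  proof -
    have "c [^] k = c [^] l \<longleftrightarrow> c [^] (k - l) = \<one>"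
      using c by (metis int_pow_diff int_pow_closed inv_closed inv_solve_right l_one one_closed r_inv)
    also have "\<dots> \<longleftrightarrow> c [^] \<bar>k - l\<bar> = \<one>"
    proof (cases "k - l \<ge> 0")
      case False
      then have "\<bar>k - l\<bar> = - (k - l)" by simp
      then have "c [^] \<bar>k - l\<bar> = inv (c [^] (k - l))" using c by (simp only: int_pow_neg)
      then show ?thesis using c by (simp only: inv_eq_1_iff int_pow_closed)
    qed simp
    also have "\<dots> \<longleftrightarrow> c [^] nat \<bar>k - l\<bar> = \<one>"
      by (metis abs_ge_zero int_nat_eq int_pow_int)
    finally show ?thesis .
  qed
  show ?thesis using one assms unfolding equal_order_def by metis
qed

text \<open>The two enumerations by pairs \<open>(k, n)\<close>, for \<open>a\<close> and for \<open>b\<close>, identify the same pairs when \<open>a\<close>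
  and \<open>b\<close> have equal order. Matching them up gives a bijection that turns multiplication by \<open>a\<close> into
  multiplication by \<open>b\<close>; it is extended by the identity to the whole type.\<close>
lemma (in group) equal_order_conj_bij:
  assumes "countable (carrier G)" "a \<in> carrier G" "b \<in> carrier G"
    and ord: "equal_order G a b"
  obtains f :: "'a \<times> nat \<Rightarrow> 'a \<times> nat" where "bij f"
    "\<And>z. fst (f z) \<in> carrier G \<longleftrightarrow> fst z \<in> carrier G"
    "\<And>(k::int) x n. x \<in> carrier G \<Longrightarrow> f (a [^] k \<otimes> x, n) = (b [^] k \<otimes> fst (f (x, n)), snd (f (x, n)))"
    "\<And>z. fst z \<notin> carrier G \<Longrightarrow> f z = z"
proof -
  obtain ea :: "nat \<Rightarrow> 'a \<times> nat" where ea: "\<And>n. fst (ea n) \<in> carrier G"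
    "\<And>x m. x \<in> carrier G \<Longrightarrow> \<exists>(k::int) n. (a [^] k \<otimes> fst (ea n), snd (ea n)) = (x, m)"
    "\<And>(k::int) (l::int) n m. (a [^] k \<otimes> fst (ea n), snd (ea n)) = (a [^] l \<otimes> fst (ea m), snd (ea m))
      \<Longrightarrow> n = m \<and> a [^] k = a [^] l"
    using cyclic_cosets_enumeration[OF assms(1,2)] by blast
  obtain eb :: "nat \<Rightarrow> 'a \<times> nat" where eb: "\<And>n. fst (eb n) \<in> carrier G"
    "\<And>x m. x \<in> carrier G \<Longrightarrow> \<exists>(k::int) n. (b [^] k \<otimes> fst (eb n), snd (eb n)) = (x, m)"
    "\<And>(k::int) (l::int) n m. (b [^] k \<otimes> fst (eb n), snd (eb n)) = (b [^] l \<otimes> fst (eb m), snd (eb m))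
      \<Longrightarrow> n = m \<and> b [^] k = b [^] l"
    using cyclic_cosets_enumeration[OF assms(1,3)] by blast
  define \<alpha> where "\<alpha> = (\<lambda>(k::int, n). (a [^] k \<otimes> fst (ea n), snd (ea n)))"
  define \<beta> where "\<beta> = (\<lambda>(k::int, n). (b [^] k \<otimes> fst (eb n), snd (eb n)))"
  let ?C = "carrier G \<times> (UNIV :: nat set)"
  have ker: "\<alpha> i = \<alpha> j \<longleftrightarrow> \<beta> i = \<beta> j" for i j
  proof -
    obtain k n l m where ij: "i = (k, n)" "j = (l, m)" by fastforce
    have "\<alpha> i = \<alpha> j \<longleftrightarrow> n = m \<and> a [^] k = a [^] l"
      unfolding ij \<alpha>_def using ea(3)[of k n l m] by auto
    moreover have "\<beta> i = \<beta> j \<longleftrightarrow> n = m \<and> b [^] k = b [^] l"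
      unfolding ij \<beta>_def using eb(3)[of k n l m] by auto
    ultimately show ?thesis
      using int_pow_eq_iff_of_nat_pow[OF assms(2,3) ord] by blast
  qed
  have range: "range \<alpha> = ?C" "range \<beta> = ?C"
  proof -
    show "range \<alpha> = ?C"
    proof (intro equalityI subsetI)
      fix z assume "z \<in> ?C"
      then obtain k n where "\<alpha> (k, n) = z" using ea(2)[of "fst z" "snd z"] unfolding \<alpha>_def by auto
      then show "z \<in> range \<alpha>" by blast
    qed (use ea(1) assms(2) in \<open>auto simp: \<alpha>_def\<close>)
    show "range \<beta> = ?C"
    proof (intro equalityI subsetI)
      fix z assume "z \<in> ?C"
      then obtain k n where "\<beta> (k, n) = z" using eb(2)[of "fst z" "snd z"] unfolding \<beta>_def by auto
      then show "z \<in> range \<beta>" by blast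
    qed (use eb(1) assms(3) in \<open>auto simp: \<beta>_def\<close>)
  qed
  obtain h where h: "bij_betw h ?C ?C" "\<And>i. h (\<alpha> i) = \<beta> i"
    using bij_betw_of_same_kernel[of \<alpha> \<beta>, OF ker] range by metis
  define f where "f z = (if z \<in> ?C then h z else z)" for z
  have f_C: "f z \<in> ?C \<longleftrightarrow> z \<in> ?C" for z
    using h(1) unfolding f_def by (auto dest: bij_betw_apply)
  show ?thesis
  proof
    have "bij_betw f (?C \<union> - ?C) (?C \<union> - ?C)"
    proof (rule bij_betw_combine)
      show "bij_betw f ?C ?C"
        using h(1) bij_betw_cong[of ?C f h] unfolding f_def by auto
      show "bij_betw f (- ?C) (- ?C)"
        using bij_betw_cong[of "- ?C" f id] unfolding f_def by auto
    qed auto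
    then show "bij f" by (simp only: Compl_partition)
    show "fst (f z) \<in> carrier G \<longleftrightarrow> fst z \<in> carrier G" for z
      using f_C[of z] by (simp add: mem_Times_iff)
    show "f (a [^] k \<otimes> x, n) = (b [^] k \<otimes> fst (f (x, n)), snd (f (x, n)))"
      if x: "x \<in> carrier G" for k :: int and x n
    proof -
      have "(x, n) \<in> range \<alpha>" using x range(1) by blast
      then obtain l m where lm: "(x, n) = \<alpha> (l, m)" by auto
      then have "(a [^] k \<otimes> x, n) = \<alpha> (k + l, m)"
        using ea(1) assms(2) by (simp add: \<alpha>_def int_pow_mult m_assoc)
      moreover have "(a [^] k \<otimes> x, n) \<in> ?C" using x assms(2) by simp
      ultimately have "f (a [^] k \<otimes> x, n) = \<beta> (k + l, m)"
        using h(2) unfolding f_def by metis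
      moreover have "f (x, n) = \<beta> (l, m)"
        using x h(2)[of "(l, m)"] unfolding f_def lm[symmetric] by simp
      ultimately show ?thesis
        using eb(1) assms(3) by (simp add: \<beta>_def int_pow_mult m_assoc)
    qed
    show "f z = z" if "fst z \<notin> carrier G" for z
      using that by (simp add: f_def mem_Times_iff)
  qed
qed

text \<open>Extended by the identity outside the carrier, so that translations are permutations of the
  whole type.\<close>
definition (in group) translate :: "'a \<Rightarrow> 'a \<times> nat \<Rightarrow> 'a \<times> nat" where
  "translate g z = (if fst z \<in> carrier G then (g \<otimes> fst z, snd z) else z)"

lemma (in group) translate_comp:
  "g \<in> carrier G \<Longrightarrow> h \<in> carrier G \<Longrightarrow> translate g \<circ> translate h = translate (g \<otimes> h)"
  by (auto simp: translate_def fun_eq_iff m_assoc)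

lemma (in group) translate_one: "translate \<one> = id"
  by (auto simp: translate_def fun_eq_iff)

lemma (in group) inj_translate_image: "inj_on (\<lambda>g. image (translate g)) (carrier G)"
proof (rule inj_onI)
  fix g h assume gh: "g \<in> carrier G" "h \<in> carrier G" "image (translate g) = image (translate h)"
  have "translate g ` {(\<one>, 0)} = translate h ` {(\<one>, 0)}" unfolding gh(3) ..
  then show "g = h" using gh by (simp add: translate_def)
qed

lemma image_o_image: "image f \<circ> image g = image (f \<circ> g)"
  by (rule ext) (simp add: image_comp)

lemma bij_image:
  assumes "bij f"
  shows "bij (image f)" "perm_inv (image f) = image (perm_inv f)"
proof -
  have *: "image f \<circ> image (perm_inv f) = id" "image (perm_inv f) \<circ> image f = id"
    using assms by (simp_all add: image_o_image bij_is_inj surj_iff[THEN iffD1, OF bij_is_surj])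
  then show "perm_inv (image f) = image (perm_inv f)" by (rule inv_unique_comp)
  show "bij (image f)" using * o_bij by blast
qed

text \<open>The group acts on subsets of \<open>G \<times> \<nat>\<close> rather than on points, since translations have no fixed
  points: the subset \<open>x0 = \<langle>b\<rangle> \<times> {0}\<close> has the stabiliser \<open>\<langle>b\<rangle>\<close>, and its preimage under \<open>f\<close> is an
  \<open>a\<close>-cycle with the stabiliser \<open>\<langle>a\<rangle>\<close>. For \<open>a = 1\<close> both are trivial, and
  \<open>base_conj_infinite_order\<close> applies to every \<open>g \<noteq> 1\<close>.\<close>
theorem (in group) hnn_extension:
  assumes count: "countable (carrier G)" and ab: "a \<in> carrier G" "b \<in> carrier G"
    and ord: "equal_order G a b"
  obtains H :: "((('a \<times> nat) set \<times> bool) list \<times> (('a \<times> nat) set \<Rightarrow> ('a \<times> nat) set)) monoid"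
    and \<iota> t
  where "group H" "countable (carrier H)" "\<iota> \<in> hom G H" "inj_on \<iota> (carrier G)"
    "t \<in> carrier H" "t \<otimes>\<^bsub>H\<^esub> \<iota> a = \<iota> b \<otimes>\<^bsub>H\<^esub> t"
    "\<forall>E. subgroup E H \<longrightarrow> finite E \<longrightarrow> (\<exists>F. subgroup F G \<and> finite F \<and> card F = card E)"
    "\<forall>g \<in> carrier G. infinite_order H (t \<otimes>\<^bsub>H\<^esub> \<iota> g)"
    "a = \<one> \<longrightarrow> (\<forall>g \<in> carrier G - {\<one>}.
      infinite_order H (\<iota> g \<otimes>\<^bsub>H\<^esub> (t \<otimes>\<^bsub>H\<^esub> \<iota> g \<otimes>\<^bsub>H\<^esub> inv\<^bsub>H\<^esub> t)))"
proof -
  obtain f :: "'a \<times> nat \<Rightarrow> 'a \<times> nat" where f: "bij f"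
    "\<And>z. fst (f z) \<in> carrier G \<longleftrightarrow> fst z \<in> carrier G"
    "\<And>(k::int) x n. x \<in> carrier G \<Longrightarrow> f (a [^] k \<otimes> x, n) = (b [^] k \<otimes> fst (f (x, n)), snd (f (x, n)))"
    "\<And>z. fst z \<notin> carrier G \<Longrightarrow> f z = z"
    using equal_order_conj_bij[OF assms] by blast
  have f_inv: "f (perm_inv f z) = z" "perm_inv f (f z) = z" for z
    using f(1) by (simp_all add: bij_is_inj bij_is_surj surj_f_inv_f)
  define \<phi> where "\<phi> g = image (translate g)" for g
  define x0 :: "('a \<times> nat) set" where "x0 = range (\<lambda>k::int. (b [^] k, 0))"
  have \<phi>_comp: "\<phi> g \<circ> \<phi> h = \<phi> (g \<otimes> h)" if "g \<in> carrier G" "h \<in> carrier G" for g h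
    using translate_comp[OF that] by (simp add: \<phi>_def image_o_image)
  have \<phi>_one: "\<phi> \<one> = id"
    by (simp add: \<phi>_def translate_one fun_eq_iff)
  have \<phi>_inv: "perm_inv (\<phi> g) = \<phi> (inv g)" "bij (\<phi> g)" if "g \<in> carrier G" for g
  proof -
    have *: "\<phi> g \<circ> \<phi> (inv g) = id" "\<phi> (inv g) \<circ> \<phi> g = id"
      using that by (simp_all add: \<phi>_comp \<phi>_one)
    then show "perm_inv (\<phi> g) = \<phi> (inv g)" by (rule inv_unique_comp)
    show "bij (\<phi> g)" using * o_bij by blast
  qed
  have \<phi>_inj: "inj_on \<phi> (carrier G)"
    using inj_translate_image by (simp add: \<phi>_def[abs_def])
  have q: "bij (image f)" "perm_inv (image f) = image (perm_inv f)"
    using bij_image[OF f(1)] by auto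
  have f_translate: "f \<circ> translate (a [^] k) = translate (b [^] k) \<circ> f" for k :: int
  proof
    fix z
    show "(f \<circ> translate (a [^] k)) z = (translate (b [^] k) \<circ> f) z"
      using f(2)[of z] f(3)[of "fst z" k "snd z"] f(4)[of z] by (auto simp: translate_def)
  qed
  have q_\<phi>: "image f \<circ> \<phi> (a [^] k) = \<phi> (b [^] k) \<circ> image f" for k :: int
    using f_translate[of k] by (simp add: \<phi>_def image_o_image)
  have ff: "image (perm_inv f) \<circ> image f = id" "image f \<circ> image (perm_inv f) = id"
    using f_inv by (simp_all add: image_o_image fun_eq_iff image_def)
  have q_\<phi>_a: "image (perm_inv f) \<circ> \<phi> (b [^] k) \<circ> image f = \<phi> (a [^] k)" for k :: int
    using q_\<phi>[of k] ff(1) by (metis o_assoc id_o)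
  have q_\<phi>_b: "image f \<circ> \<phi> (a [^] k) \<circ> image (perm_inv f) = \<phi> (b [^] k)" for k :: int
    using q_\<phi>[of k] ff(2) by (metis o_assoc o_id)
  have stab_x0: "\<exists>k::int. g = b [^] k" if "g \<in> carrier G" "\<phi> g x0 = x0" for g
  proof -
    have "(b [^] (0::int), 0) \<in> x0" unfolding x0_def by blast
    then have "translate g (b [^] (0::int), 0) \<in> x0" using that(2) unfolding \<phi>_def by blast
    then show ?thesis using that(1) by (auto simp: translate_def x0_def)
  qed
  have stab_qx0: "\<exists>k::int. g = a [^] k"
    if g: "g \<in> carrier G" and eq: "\<phi> g (perm_inv f ` x0) = perm_inv f ` x0" for g
  proof -
    let ?y = "perm_inv f (\<one>, 0)"
    have y: "fst ?y \<in> carrier G" using f(2)[of ?y] f_inv by simp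
    have "(\<one>, 0) \<in> x0" unfolding x0_def using int_pow_0 by (metis rangeI)
    then have "translate g ?y \<in> perm_inv f ` x0" using eq unfolding \<phi>_def by blast
    then obtain k :: int where "translate g ?y = perm_inv f (b [^] k, 0)" unfolding x0_def by auto
    moreover have "f (a [^] k \<otimes> fst ?y, snd ?y) = (b [^] k, 0)"
      using f(3)[OF y, of k "snd ?y"] ab f_inv by simp
    ultimately have "translate g ?y = (a [^] k \<otimes> fst ?y, snd ?y)" using f_inv by metis
    then have "g \<otimes> fst ?y = a [^] k \<otimes> fst ?y" using y by (simp add: translate_def)
    then show ?thesis using g y ab by auto
  qed
  interpret S: stable_letter "\<phi> ` carrier G" "image f" x0
  proof
    show "bij g" if "g \<in> \<phi> ` carrier G" for g using that \<phi>_inv by auto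
    show "id \<in> \<phi> ` carrier G" using \<phi>_one by (metis imageI one_closed)
    show "g \<circ> g' \<in> \<phi> ` carrier G" if "g \<in> \<phi> ` carrier G" "g' \<in> \<phi> ` carrier G" for g g'
      using that \<phi>_comp by auto
    show "perm_inv g \<in> \<phi> ` carrier G" if "g \<in> \<phi> ` carrier G" for g
      using that \<phi>_inv by auto
    show "bij (image f)" by fact
    show "perm_inv (image f) \<circ> g \<circ> image f \<in> \<phi> ` carrier G"
      if g: "g \<in> \<phi> ` carrier G" "g x0 = x0" for g
    proof -
      obtain x where x: "x \<in> carrier G" "g = \<phi> x" using g(1) by blast
      obtain k :: int where "x = b [^] k" using stab_x0[OF x(1)] g(2) x(2) by metis
      then show ?thesis using q_\<phi>_a[of k] x(2) ab(1) unfolding q(2) by simp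
    qed
    show "image f \<circ> g \<circ> perm_inv (image f) \<in> \<phi> ` carrier G"
      if g: "g \<in> \<phi> ` carrier G" "g (perm_inv (image f) x0) = perm_inv (image f) x0" for g
    proof -
      obtain x where x: "x \<in> carrier G" "g = \<phi> x" using g(1) by blast
      obtain k :: int where "x = a [^] k" using stab_qx0[OF x(1)] g(2) x(2) unfolding q(2) by metis
      then show ?thesis using q_\<phi>_b[of k] x(2) ab(2) unfolding q(2) by simp
    qed
  qed
  let ?H = "free_sym\<lparr>carrier := S.hnn\<rparr>"
  let ?t = "S.stable True" and ?\<iota> = "\<lambda>g. ([], \<phi> g)"
  have base: "?\<iota> g \<in> S.hnn" if "g \<in> carrier G" for g
    using that S.hnn.base by blast
  have pow: "x [^]\<^bsub>?H\<^esub> n = x [^]\<^bsub>free_sym\<^esub> n" for x and n :: nat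
    using free_sym.nat_pow_consistent by metis
  have inv_t: "inv\<^bsub>?H\<^esub> ?t = inv\<^bsub>free_sym\<^esub> ?t"
    using free_sym.m_inv_consistent[OF S.subgroup_hnn S.stable_hnn] .
  show ?thesis
  proof (rule that[of ?H ?\<iota> ?t])
    show "group ?H" using free_sym.subgroup_imp_group[OF S.subgroup_hnn] .
    show "countable (carrier ?H)" using S.countable_hnn count by simp
    show "?\<iota> \<in> hom G ?H"
      using base by (auto intro!: homI simp: mult_free_sym \<phi>_comp)
    show "inj_on ?\<iota> (carrier G)"
      using \<phi>_inj by (auto simp: inj_on_def)
    show "?t \<in> carrier ?H" using S.stable_hnn by simp
    have "\<phi> b x0 = x0"
    proof -
      have "\<phi> b x0 = range (\<lambda>k::int. (b [^] (1 + k), 0))"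
        using ab(2) by (auto simp: \<phi>_def x0_def translate_def int_pow_mult image_comp)
      also have "\<dots> = x0"
        unfolding x0_def
      proof (intro equalityI subsetI)
        fix z :: "'a \<times> nat" assume "z \<in> range (\<lambda>k::int. (b [^] k, 0))"
        then obtain k :: int where "z = (b [^] (1 + (k - 1)), 0)" by auto
        then show "z \<in> range (\<lambda>k::int. (b [^] (1 + k), 0))" by blast
      qed blast
      finally show ?thesis .
    qed
    then show "?t \<otimes>\<^bsub>?H\<^esub> ?\<iota> a = ?\<iota> b \<otimes>\<^bsub>?H\<^esub> ?t"
      using q_\<phi>[of 1] ab by (simp add: S.stable_def mult_free_sym S.pt_def S.qs_def relabel_def)
    show "\<forall>E. subgroup E ?H \<longrightarrow> finite E \<longrightarrow> (\<exists>F. subgroup F G \<and> finite F \<and> card F = card E)"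
    proof (intro allI impI)
      fix E assume E: "subgroup E ?H" "finite E"
      have "subgroup E free_sym" "E \<subseteq> S.hnn"
        using E(1) free_sym.incl_subgroup[OF S.subgroup_hnn] subgroup.subset by fastforce+
      then obtain F where F: "F \<subseteq> \<phi> ` carrier G" "card F = card E" "finite F" "id \<in> F"
        "\<And>g g'. g \<in> F \<Longrightarrow> g' \<in> F \<Longrightarrow> g \<circ> g' \<in> F" "\<And>g. g \<in> F \<Longrightarrow> perm_inv g \<in> F"
        using S.finite_subgroup_hnn_card E(2) by metis
      let ?F = "{g \<in> carrier G. \<phi> g \<in> F}"
      have "\<phi> ` ?F = F" using F(1) by blast
      moreover have inj: "inj_on \<phi> ?F" using \<phi>_inj by (rule inj_on_subset) blast
      ultimately have "card ?F = card E" "finite ?F"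
        using F(2,3) card_image[OF inj] finite_imageD[OF _ inj] by auto
      moreover have "subgroup ?F G"
      proof (rule subgroupI)
        show "?F \<noteq> {}" using F(4) \<phi>_one by force
        show "inv g \<in> ?F" if "g \<in> ?F" for g using that F(6)[of "\<phi> g"] \<phi>_inv by auto
        show "g \<otimes> h \<in> ?F" if "g \<in> ?F" "h \<in> ?F" for g h
          using that F(5)[of "\<phi> g" "\<phi> h"] \<phi>_comp by auto
      qed auto
      ultimately show "\<exists>F. subgroup F G \<and> finite F \<and> card F = card E" by blast
    qed
    show "\<forall>g \<in> carrier G. infinite_order ?H (?t \<otimes>\<^bsub>?H\<^esub> ?\<iota> g)"
      using S.stable_base_infinite_order by (simp add: pow infinite_order_def)
    show "a = \<one> \<longrightarrow> (\<forall>g \<in> carrier G - {\<one>}.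
      infinite_order ?H (?\<iota> g \<otimes>\<^bsub>?H\<^esub> (?t \<otimes>\<^bsub>?H\<^esub> ?\<iota> g \<otimes>\<^bsub>?H\<^esub> inv\<^bsub>?H\<^esub> ?t)))"
    proof (intro impI ballI)
      fix g assume a: "a = \<one>" and g: "g \<in> carrier G - {\<one>}"
      have "b = \<one>" using ord a ab unfolding equal_order_def by (metis nat_pow_eone nat_pow_one)
      then have "\<phi> g x0 \<noteq> x0" "\<phi> g (perm_inv (image f) x0) \<noteq> perm_inv (image f) x0"
        using stab_x0[of g] stab_qx0[of g] a g unfolding q(2) by auto
      then show "infinite_order ?H (?\<iota> g \<otimes>\<^bsub>?H\<^esub> (?t \<otimes>\<^bsub>?H\<^esub> ?\<iota> g \<otimes>\<^bsub>?H\<^esub> inv\<^bsub>?H\<^esub> ?t))"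
        using S.base_conj_infinite_order[of "\<phi> g"] g by (simp add: pow inv_t infinite_order_def)
    qed
  qed
qed

section \<open>A chain of extensions on a fixed carrier type\<close>

text \<open>Successive HNN extensions live on ever larger types. Since all of them are countable, each is
  copied to \<^typ>\<open>nat\<close> in such a way that the smaller group becomes an actual subset of the larger
  one. The limit is then a union.\<close>
definition transport :: "('a \<Rightarrow> 'b) \<Rightarrow> ('a, 'c) monoid_scheme \<Rightarrow> 'b monoid" where
  "transport j G = \<lparr>carrier = j ` carrier G,
     monoid.mult = (\<lambda>x y. j (inv_into (carrier G) j x \<otimes>\<^bsub>G\<^esub> inv_into (carrier G) j y)),
     one = j \<one>\<^bsub>G\<^esub>\<rparr>"

lemma carrier_transport: "carrier (transport j G) = j ` carrier G"
  by (simp add: transport_def)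

lemma (in group) transport_group_hom:
  assumes "inj_on j (carrier G)"
  shows "group_hom G (transport j G) j"
proof -
  have mult: "j x \<otimes>\<^bsub>transport j G\<^esub> j y = j (x \<otimes> y)" if "x \<in> carrier G" "y \<in> carrier G" for x y
    using that assms by (simp add: transport_def)
  have "group (transport j G)"
  proof (rule groupI)
    show "\<one>\<^bsub>transport j G\<^esub> \<in> carrier (transport j G)"
      by (simp add: transport_def)
    fix x' assume "x' \<in> carrier (transport j G)"
    then obtain x where x: "x' = j x" "x \<in> carrier G" by (auto simp: carrier_transport)
    have "j \<one> = \<one>\<^bsub>transport j G\<^esub>" by (simp add: transport_def)
    with x mult[of \<one> x] mult[of "inv x" x]
    show "\<one>\<^bsub>transport j G\<^esub> \<otimes>\<^bsub>transport j G\<^esub> x' = x'"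
      "\<exists>y \<in> carrier (transport j G). y \<otimes>\<^bsub>transport j G\<^esub> x' = \<one>\<^bsub>transport j G\<^esub>"
      by (auto simp: carrier_transport)
  qed (auto simp: carrier_transport mult m_assoc)
  then show ?thesis
    unfolding group_hom_def group_hom_axioms_def
    by (auto simp: hom_def carrier_transport mult is_group)
qed

definition extends :: "'a monoid \<Rightarrow> 'a monoid \<Rightarrow> bool" (infix "\<unlhd>\<^sub>e" 50) where
  "G \<unlhd>\<^sub>e H \<longleftrightarrow> group G \<and> group H \<and> carrier G \<subseteq> carrier H \<and>
     (\<forall>x \<in> carrier G. \<forall>y \<in> carrier G. x \<otimes>\<^bsub>G\<^esub> y = x \<otimes>\<^bsub>H\<^esub> y)"

lemma extends_group_hom: "G \<unlhd>\<^sub>e H \<Longrightarrow> group_hom G H id"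
  by (auto simp: extends_def group_hom_def group_hom_axioms_def hom_def)

lemma extends_one: "G \<unlhd>\<^sub>e H \<Longrightarrow> \<one>\<^bsub>H\<^esub> = \<one>\<^bsub>G\<^esub>"
  using group_hom.hom_one[OF extends_group_hom] by fastforce

lemma extends_inv: "G \<unlhd>\<^sub>e H \<Longrightarrow> x \<in> carrier G \<Longrightarrow> inv\<^bsub>H\<^esub> x = inv\<^bsub>G\<^esub> x"
  using group_hom.hom_inv[OF extends_group_hom] by fastforce

lemma extends_pow: "G \<unlhd>\<^sub>e H \<Longrightarrow> x \<in> carrier G \<Longrightarrow> x [^]\<^bsub>H\<^esub> (n::nat) = x [^]\<^bsub>G\<^esub> n"
  using group_hom.hom_nat_pow[OF extends_group_hom] by fastforce

lemma extends_trans: "G \<unlhd>\<^sub>e H \<Longrightarrow> H \<unlhd>\<^sub>e K \<Longrightarrow> G \<unlhd>\<^sub>e K"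
  by (auto simp: extends_def subset_iff)

lemma extends_subgroup:
  assumes "G \<unlhd>\<^sub>e H" "subgroup E H" "E \<subseteq> carrier G"
  shows "subgroup E G"
proof -
  interpret G: group G using assms(1) by (simp add: extends_def)
  interpret E: subgroup E H by fact
  show ?thesis
  proof (rule G.subgroupI)
    show "inv\<^bsub>G\<^esub> x \<in> E" if "x \<in> E" for x
      using that assms extends_inv E.m_inv_closed by (metis subsetD)
    show "x \<otimes>\<^bsub>G\<^esub> y \<in> E" if "x \<in> E" "y \<in> E" for x y
      using that assms E.m_closed unfolding extends_def by (metis subsetD)
    show "E \<noteq> {}" using E.one_closed by blast
  qed (use assms in auto)
qed

definition finite_subgroups_order :: "nat \<Rightarrow> ('a, 'b) monoid_scheme \<Rightarrow> bool" where
  "finite_subgroups_order p G \<longleftrightarrow> (\<forall>E. subgroup E G \<longrightarrow> finite E \<longrightarrow> card E = 1 \<or> card E = p)"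

text \<open>The invariant of the chain. Natural numbers are used as codes of pairs. The bound on the first
  component leaves infinitely many codes for the elements of the next extension.\<close>
definition stage :: "nat \<Rightarrow> nat monoid \<Rightarrow> bool" where
  "stage p G \<longleftrightarrow> group G \<and> (\<exists>n. \<forall>x \<in> carrier G. fst (prod_decode x) \<le> n) \<and>
     finite_subgroups_order p G"

lemma stage_extension:
  assumes G: "stage p G" and ab: "a \<in> carrier G" "b \<in> carrier G" "equal_order G a b"
  obtains G' t where "stage p G'" "G \<unlhd>\<^sub>e G'" "t \<in> carrier G'" "t \<otimes>\<^bsub>G'\<^esub> a = b \<otimes>\<^bsub>G'\<^esub> t"
    "\<forall>g \<in> carrier G. infinite_order G' (t \<otimes>\<^bsub>G'\<^esub> g)"
    "a = \<one>\<^bsub>G\<^esub> \<longrightarrow> (\<forall>g \<in> carrier G - {\<one>\<^bsub>G\<^esub>}.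
      infinite_order G' (g \<otimes>\<^bsub>G'\<^esub> (t \<otimes>\<^bsub>G'\<^esub> g \<otimes>\<^bsub>G'\<^esub> inv\<^bsub>G'\<^esub> t)))"
proof -
  interpret G: group G using G by (simp add: stage_def)
  obtain N where N: "\<And>x. x \<in> carrier G \<Longrightarrow> fst (prod_decode x) \<le> N"
    using G unfolding stage_def by blast
  obtain H :: "(((nat \<times> nat) set \<times> bool) list \<times> ((nat \<times> nat) set \<Rightarrow> (nat \<times> nat) set)) monoid"
    and \<iota> t
    where H: "group H" "countable (carrier H)" and \<iota>: "\<iota> \<in> hom G H" "inj_on \<iota> (carrier G)"
      and t: "t \<in> carrier H" "t \<otimes>\<^bsub>H\<^esub> \<iota> a = \<iota> b \<otimes>\<^bsub>H\<^esub> t"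
      and fin: "\<forall>E. subgroup E H \<longrightarrow> finite E \<longrightarrow> (\<exists>F. subgroup F G \<and> finite F \<and> card F = card E)"
      and inf1: "\<forall>g \<in> carrier G. infinite_order H (t \<otimes>\<^bsub>H\<^esub> \<iota> g)"
      and inf2: "a = \<one>\<^bsub>G\<^esub> \<longrightarrow> (\<forall>g \<in> carrier G - {\<one>\<^bsub>G\<^esub>}.
        infinite_order H (\<iota> g \<otimes>\<^bsub>H\<^esub> (t \<otimes>\<^bsub>H\<^esub> \<iota> g \<otimes>\<^bsub>H\<^esub> inv\<^bsub>H\<^esub> t)))"
    by (rule G.hnn_extension[OF countableI_type ab])
  interpret H: group H by fact
  interpret \<iota>: group_hom G H \<iota>
    using \<iota>(1) by (simp add: group_hom_def group_hom_axioms_def G.is_group H.is_group)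
  \<comment> \<open>Elements of \<open>G\<close> keep their names; new elements receive the fresh first component \<open>Suc N\<close>.\<close>
  define j where "j h = (if h \<in> \<iota> ` carrier G then inv_into (carrier G) \<iota> h
    else prod_encode (Suc N, to_nat_on (carrier H) h))" for h
  have j_\<iota>: "j (\<iota> g) = g" if "g \<in> carrier G" for g
    using that \<iota>(2) by (simp add: j_def)
  have j_new: "fst (prod_decode (j h)) = Suc N" if "h \<notin> \<iota> ` carrier G" for h
    using that by (simp add: j_def)
  have j_old: "fst (prod_decode (j h)) \<le> N" if "h \<in> \<iota> ` carrier G" for h
    using that j_\<iota> N by auto
  have inj: "inj_on j (carrier H)"
  proof (rule inj_onI)
    fix h k assume hk: "h \<in> carrier H" "k \<in> carrier H" "j h = j k"
    have iff: "h \<in> \<iota> ` carrier G \<longleftrightarrow> k \<in> \<iota> ` carrier G"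
      using j_new j_old hk(3) by (metis Suc_n_not_le_n)
    show "h = k"
    proof (cases "h \<in> \<iota> ` carrier G")
      case True
      then show ?thesis using iff j_\<iota> hk(3) by auto
    next
      case False
      then have "to_nat_on (carrier H) h = to_nat_on (carrier H) k"
        using iff hk(3) by (simp add: j_def)
      then show ?thesis using hk H(2) by simp
    qed
  qed
  let ?G' = "transport j H"
  interpret j: group_hom H ?G' j by (rule H.transport_group_hom[OF inj])
  have ext: "G \<unlhd>\<^sub>e ?G'"
    unfolding extends_def
  proof (intro conjI ballI)
    show "carrier G \<subseteq> carrier ?G'"
      using j_\<iota> \<iota>.hom_closed unfolding carrier_transport by (metis imageI subsetI)
    show "x \<otimes>\<^bsub>G\<^esub> y = x \<otimes>\<^bsub>?G'\<^esub> y" if "x \<in> carrier G" "y \<in> carrier G" for x y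
      using that j.hom_mult[of "\<iota> x" "\<iota> y"] by (simp add: \<iota>.hom_mult[symmetric] j_\<iota> del: \<iota>.hom_mult j.hom_mult)
  qed (rule G.is_group j.H.is_group)+
  have inf: "infinite_order ?G' (j h)"
    if h: "h \<in> carrier H" and ne: "infinite_order H h" for h
    unfolding infinite_order_def
  proof (intro allI impI)
    fix n :: nat assume n: "n > 0"
    have "j (h [^]\<^bsub>H\<^esub> n) \<noteq> j \<one>\<^bsub>H\<^esub>"
      using ne n inj h unfolding infinite_order_def by (simp add: inj_on_eq_iff del: j.hom_one)
    then show "j h [^]\<^bsub>?G'\<^esub> n \<noteq> \<one>\<^bsub>?G'\<^esub>" using h by (simp add: j.hom_nat_pow)
  qed
  show ?thesis
  proof (rule that[of ?G' "j t"])
    show "G \<unlhd>\<^sub>e ?G'" by (rule ext)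
    show "j t \<in> carrier ?G'" using t(1) by simp
    show "j t \<otimes>\<^bsub>?G'\<^esub> a = b \<otimes>\<^bsub>?G'\<^esub> j t"
      using t j.hom_mult[of t "\<iota> a"] j.hom_mult[of "\<iota> b" t] ab by (simp add: j_\<iota> del: j.hom_mult)
    show "\<forall>g \<in> carrier G. infinite_order ?G' (j t \<otimes>\<^bsub>?G'\<^esub> g)"
    proof
      fix g assume g: "g \<in> carrier G"
      show "infinite_order ?G' (j t \<otimes>\<^bsub>?G'\<^esub> g)"
        using inf[of "t \<otimes>\<^bsub>H\<^esub> \<iota> g"] inf1 t(1) g by (simp add: j_\<iota>)
    qed
    show "a = \<one>\<^bsub>G\<^esub> \<longrightarrow> (\<forall>g \<in> carrier G - {\<one>\<^bsub>G\<^esub>}.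
      infinite_order ?G' (g \<otimes>\<^bsub>?G'\<^esub> (j t \<otimes>\<^bsub>?G'\<^esub> g \<otimes>\<^bsub>?G'\<^esub> inv\<^bsub>?G'\<^esub> j t)))"
    proof (intro impI ballI)
      fix g assume g: "a = \<one>\<^bsub>G\<^esub>" "g \<in> carrier G - {\<one>\<^bsub>G\<^esub>}"
      show "infinite_order ?G' (g \<otimes>\<^bsub>?G'\<^esub> (j t \<otimes>\<^bsub>?G'\<^esub> g \<otimes>\<^bsub>?G'\<^esub> inv\<^bsub>?G'\<^esub> j t))"
        using inf[of "\<iota> g \<otimes>\<^bsub>H\<^esub> (t \<otimes>\<^bsub>H\<^esub> \<iota> g \<otimes>\<^bsub>H\<^esub> inv\<^bsub>H\<^esub> t)"] inf2 t(1) g by (simp add: j_\<iota>)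
    qed
    show "stage p ?G'"
      unfolding stage_def
    proof (intro conjI)
      show "group ?G'" by (rule j.H.is_group)
      show "\<exists>n. \<forall>x \<in> carrier ?G'. fst (prod_decode x) \<le> n"
        using j_new j_old by (intro exI[of _ "Suc N"]) (metis carrier_transport imageE le_SucI order_refl)
      show "finite_subgroups_order p ?G'"
        unfolding finite_subgroups_order_def
      proof (intro allI impI)
        fix E assume E: "subgroup E ?G'" "finite E"
        let ?E = "{h \<in> carrier H. j h \<in> E}"
        interpret E: subgroup E ?G' by fact
        have img: "j ` ?E = E" using E.subset unfolding carrier_transport by blast
        have inj': "inj_on j ?E" using inj by (rule inj_on_subset) blast
        have "\<one>\<^bsub>H\<^esub> \<in> ?E" using E.one_closed by simp
        then have "?E \<noteq> {}" by blast
        then have "subgroup ?E H" by (rule H.subgroupI[rotated]) auto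
        moreover have "finite ?E" by (rule finite_imageD[OF _ inj']) (simp only: img E(2))
        ultimately obtain F where "subgroup F G" "finite F" "card F = card ?E"
          using fin by blast
        moreover have "card ?E = card E" using card_image[OF inj'] img by simp
        ultimately show "card E = 1 \<or> card E = p"
          using G unfolding stage_def finite_subgroups_order_def by metis
      qed
    qed
  qed
qed

lemma stage_cyclic:
  assumes "prime p"
  obtains G x where "stage p G" "x \<in> carrier G" "x \<noteq> \<one>\<^bsub>G\<^esub>" "x [^]\<^bsub>G\<^esub> p = \<one>\<^bsub>G\<^esub>"
proof -
  let ?Z = "integer_mod_group p" and ?G = "transport nat (integer_mod_group p)"
  interpret Z: group ?Z by simp
  have car: "carrier ?Z = {0..<int p}"
    using prime_gt_0_nat[OF assms] by (simp add: carrier_integer_mod_group)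
  have inj: "inj_on nat (carrier ?Z)" unfolding car by (auto simp: inj_on_def)
  interpret j: group_hom ?Z ?G nat by (rule Z.transport_group_hom[OF inj])
  have order: "order ?G = p" and fin: "finite (carrier ?G)"
    using card_image[OF inj] by (simp_all add: order_def carrier_transport car)
  have "stage p ?G"
    unfolding stage_def
  proof (intro conjI)
    show "group ?G" by (rule j.H.is_group)
    show "\<exists>n. \<forall>x \<in> carrier ?G. fst (prod_decode x) \<le> n"
      using fin by (intro exI[of _ "Max ((\<lambda>x. fst (prod_decode x)) ` carrier ?G)"]) simp
    show "finite_subgroups_order p ?G"
      unfolding finite_subgroups_order_def
    proof (intro allI impI)
      fix E assume "subgroup E ?G" "finite E"
      then have "card E dvd p" using j.H.lagrange order by (metis dvd_triv_right)
      then show "card E = 1 \<or> card E = p" using assms prime_nat_iff by blast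
    qed
  qed
  moreover obtain x where "x \<in> carrier ?G" "x \<noteq> \<one>\<^bsub>?G\<^esub>"
  proof -
    have "carrier ?G \<noteq> {\<one>\<^bsub>?G\<^esub>}"
      using order prime_gt_1_nat[OF assms] by (auto simp: order_def)
    then show ?thesis using that j.H.one_closed by blast
  qed
  ultimately show ?thesis using that j.H.pow_order_eq_1 order by metis
qed

section \<open>Unions of chains\<close>

locale group_chain =
  fixes G :: "nat \<Rightarrow> 'a monoid"
  assumes step: "G n \<unlhd>\<^sub>e G (Suc n)"
begin

lemma extends_le: "n \<le> m \<Longrightarrow> G n \<unlhd>\<^sub>e G m"
proof (induction m rule: dec_induct)
  case base
  then show ?case using step[of n] by (simp add: extends_def)
next
  case (step m)
  then show ?case using group_chain.step[OF group_chain_axioms] extends_trans by blast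
qed

text \<open>The product of two elements may be computed at any stage that contains both; the least such
  stage is chosen to have a definition.\<close>
definition limit :: "'a monoid" where
  "limit = \<lparr>carrier = (\<Union>n. carrier (G n)),
     monoid.mult = (\<lambda>x y. x \<otimes>\<^bsub>G (LEAST n. x \<in> carrier (G n) \<and> y \<in> carrier (G n))\<^esub> y),
     one = \<one>\<^bsub>G 0\<^esub>\<rparr>"

lemma limit_carrier: "carrier limit = (\<Union>n. carrier (G n))"
  by (simp add: limit_def)

lemma group_G: "group (G n)"
  using step by (simp add: extends_def)

lemma carrier_mono: "n \<le> m \<Longrightarrow> carrier (G n) \<subseteq> carrier (G m)"
  using extends_le by (auto simp: extends_def)

lemma limit_mult:
  assumes "x \<in> carrier (G n)" "y \<in> carrier (G n)"
  shows "x \<otimes>\<^bsub>limit\<^esub> y = x \<otimes>\<^bsub>G n\<^esub> y"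
proof -
  let ?m = "LEAST n. x \<in> carrier (G n) \<and> y \<in> carrier (G n)"
  have "x \<in> carrier (G ?m) \<and> y \<in> carrier (G ?m)"
    by (rule LeastI[of _ n]) (use assms in blast)
  moreover have "?m \<le> n" by (rule Least_le) (use assms in blast)
  then have "G ?m \<unlhd>\<^sub>e G n" by (rule extends_le)
  ultimately have "x \<otimes>\<^bsub>G ?m\<^esub> y = x \<otimes>\<^bsub>G n\<^esub> y" by (simp add: extends_def)
  then show ?thesis by (simp add: limit_def)
qed

lemma limit_one: "\<one>\<^bsub>limit\<^esub> = \<one>\<^bsub>G n\<^esub>"
  using extends_one[OF extends_le[of 0 n]] by (simp add: limit_def)

lemma common_stage:
  assumes "finite A" "A \<subseteq> carrier limit"
  shows "\<exists>n. A \<subseteq> carrier (G n)"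
  using assms
proof (induction A rule: finite_induct)
  case (insert x A)
  then obtain n m where "A \<subseteq> carrier (G n)" "x \<in> carrier (G m)"
    unfolding limit_carrier by auto
  then have "insert x A \<subseteq> carrier (G (max n m))"
    using carrier_mono[of n "max n m"] carrier_mono[of m "max n m"] by auto
  then show ?case by blast
qed simp

lemma group_limit: "group limit"
proof (rule groupI)
  show "\<one>\<^bsub>limit\<^esub> \<in> carrier limit"
    using group.is_monoid[OF group_G, of 0] monoid.one_closed limit_one[of 0]
    unfolding limit_carrier by fastforce
next
  fix x assume "x \<in> carrier limit"
  then obtain n where x: "x \<in> carrier (G n)" unfolding limit_carrier by blast
  interpret Gn: group "G n" by (rule group_G)
  show "\<one>\<^bsub>limit\<^esub> \<otimes>\<^bsub>limit\<^esub> x = x"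
    using x by (simp add: limit_one[of n] limit_mult[of _ n])
  have "inv\<^bsub>G n\<^esub> x \<otimes>\<^bsub>limit\<^esub> x = \<one>\<^bsub>limit\<^esub>"
    using x by (simp add: limit_one[of n] limit_mult[of _ n])
  then show "\<exists>y \<in> carrier limit. y \<otimes>\<^bsub>limit\<^esub> x = \<one>\<^bsub>limit\<^esub>"
    using x unfolding limit_carrier by blast
next
  fix x y assume "x \<in> carrier limit" "y \<in> carrier limit"
  then obtain n where xy: "x \<in> carrier (G n)" "y \<in> carrier (G n)"
    using common_stage[of "{x, y}"] by auto
  interpret Gn: group "G n" by (rule group_G)
  show "x \<otimes>\<^bsub>limit\<^esub> y \<in> carrier limit"
    using limit_mult[OF xy] Gn.m_closed[OF xy] unfolding limit_carrier by auto
next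
  fix x y z assume "x \<in> carrier limit" "y \<in> carrier limit" "z \<in> carrier limit"
  then obtain n where xyz: "x \<in> carrier (G n)" "y \<in> carrier (G n)" "z \<in> carrier (G n)"
    using common_stage[of "{x, y, z}"] by auto
  interpret Gn: group "G n" by (rule group_G)
  show "x \<otimes>\<^bsub>limit\<^esub> y \<otimes>\<^bsub>limit\<^esub> z = x \<otimes>\<^bsub>limit\<^esub> (y \<otimes>\<^bsub>limit\<^esub> z)"
    using xyz by (simp add: limit_mult[of _ n] Gn.m_assoc)
qed

lemma extends_limit: "G n \<unlhd>\<^sub>e limit"
  using group_G group_limit limit_mult by (auto simp: extends_def limit_carrier)

end

section \<open>Simplicity from conjugacy of elements of equal order\<close>

lemma (in group) nontrivial_finite_subgroup_cyclic:
  assumes p: "prime p" and fin: "finite_subgroups_order p G"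
    and H: "subgroup H G" "finite H" "H \<noteq> {\<one>}"
  shows "cyclic_group (G\<lparr>carrier := H\<rparr>)" "order (G\<lparr>carrier := H\<rparr>) = p"
proof -
  interpret H: subgroup H G by fact
  interpret GH: group "G\<lparr>carrier := H\<rparr>" by (rule subgroup_imp_group[OF H(1)])
  obtain c where c: "c \<in> H" "c \<noteq> \<one>" using H(3) H.one_closed by blast
  have "generate G {c} \<subseteq> H" using c(1) by (simp add: generate_subgroup_incl H(1))
  moreover have "subgroup (generate G {c}) G" using c(1) by (intro generate_is_subgroup) auto
  moreover have "c \<in> generate G {c}" "\<one> \<in> generate G {c}"
    by (auto intro: generate.incl generate.one)
  ultimately have gen: "finite (generate G {c})" "card (generate G {c}) = p"
    using fin H(2) c(2) unfolding finite_subgroups_order_def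
    by (auto dest: finite_subset simp: card_1_singleton_iff)
  have card: "card H = p"
    using fin H H.one_closed unfolding finite_subgroups_order_def
    by (metis card_1_singletonE singletonD)
  have eq: "generate G {c} = H"
    using card_subset_eq[OF H(2) \<open>generate G {c} \<subseteq> H\<close>] gen card by simp
  show "order (G\<lparr>carrier := H\<rparr>) = p" by (simp add: order_def card)
  have "H = range (\<lambda>n::int. c [^] n)"
    using c(1) generate_pow[of c] unfolding eq by auto
  then have "H = range (\<lambda>n::int. c [^]\<^bsub>G\<lparr>carrier := H\<rparr>\<^esub> n)"
    using int_pow_consistent[OF H(1) c(1)] by simp
  then show "cyclic_group (G\<lparr>carrier := H\<rparr>)"
    unfolding GH.cyclic_group using c(1) by auto
qed

lemma (in group) ord_eq_iff_equal_order:
  assumes "a \<in> carrier G" "b \<in> carrier G"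
  shows "equal_order G a b \<longleftrightarrow> ord a = ord b"
  using assms unfolding equal_order_def by (metis dvd_antisym dvd_refl pow_eq_id)

lemma (in group) ord_eq_0_iff_infinite_order:
  assumes "a \<in> carrier G"
  shows "infinite_order G a \<longleftrightarrow> ord a = 0"
  using assms unfolding infinite_order_def
  by (metis dvd_0_left_iff gr0I not_gr_zero pow_eq_id pow_ord_eq_1)

text \<open>The library function \<open>ord\<close> is \<open>0\<close> on elements of infinite order.\<close>
lemma (in group) ord_cases:
  assumes fin: "finite_subgroups_order p G" and c: "c \<in> carrier G" "c \<noteq> \<one>"
  shows "ord c = 0 \<or> ord c = p"
proof -
  have ord: "ord c = card (generate G {c})" using generate_pow_card c(1) by blast
  show ?thesis
  proof (cases "finite (generate G {c})")
    case True
    moreover have "subgroup (generate G {c}) G" using c(1) by (intro generate_is_subgroup) auto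
    ultimately have "ord c = 1 \<or> ord c = p" using fin ord unfolding finite_subgroups_order_def by metis
    then show ?thesis using ord_eq_1[OF c(1)] c(2) by auto
  qed (simp add: ord)
qed

theorem (in group) simple_of_equal_orders_conjugate:
  assumes p: "prime p" and fin: "finite_subgroups_order p G"
    and conj: "\<And>a b. a \<in> carrier G \<Longrightarrow> b \<in> carrier G \<Longrightarrow> equal_order G a b
      \<Longrightarrow> \<exists>s \<in> carrier G. s \<otimes> a = b \<otimes> s"
    and x: "x \<in> carrier G" "x \<noteq> \<one>" "x [^] p = \<one>" and t: "t \<in> carrier G"
    and inf: "infinite_order G t" "infinite_order G (t \<otimes> x)" "infinite_order G (x \<otimes> (t \<otimes> x \<otimes> inv t))"
  shows "is_simple_group G" "\<not> comm_group G" "\<not> torsion_free_group G"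
proof -
  have ord_x: "ord x = p"
    using ord_cases[OF fin x(1,2)] x pow_eq_id[OF x(1), of p] prime_gt_0_nat[OF p] by auto
  have ord_inf: "ord t = 0" "ord (t \<otimes> x) = 0" "ord (x \<otimes> (t \<otimes> x \<otimes> inv t)) = 0"
    using inf x(1) t by (simp_all add: ord_eq_0_iff_infinite_order)
  show "\<not> torsion_free_group G"
    using x prime_gt_0_nat[OF p] unfolding torsion_free_group_def by blast
  show "\<not> comm_group G"
  proof
    \<comment> \<open>In an abelian group the conjugate elements \<open>t\<close> and \<open>t x\<close> would be equal.\<close>
    assume "comm_group G"
    then interpret comm_group G .
    obtain s where s: "s \<in> carrier G" "s \<otimes> t = t \<otimes> x \<otimes> s"
      using conj[of t "t \<otimes> x"] ord_inf x(1) t by (auto simp: ord_eq_iff_equal_order)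
    then have "(t \<otimes> s) \<otimes> x = (t \<otimes> s) \<otimes> \<one>" using x(1) t by (simp add: m_ac)
    then show False using s(1) x(1,2) t by simp
  qed
  show "is_simple_group G"
    unfolding is_simple_group_def
  proof (intro conjI allI impI)
    show "group G" by (rule is_group)
    show "\<not> trivial_group G" using x by (auto simp: trivial_group_def)
    fix N assume "N \<lhd> G"
    then interpret N: normal N G .
    have ord_N: "d \<in> N" if "c \<in> N" "d \<in> carrier G" "ord c = ord d" for c d
    proof -
      have c: "c \<in> carrier G" using that(1) by simp
      then have "equal_order G c d" using that by (simp add: ord_eq_iff_equal_order)
      then obtain s where s: "s \<in> carrier G" "s \<otimes> c = d \<otimes> s"
        using conj[OF c \<open>d \<in> carrier G\<close>] by blast
      then have "d = s \<otimes> c \<otimes> inv s" using that(2) by (simp add: m_assoc)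
      then show ?thesis using N.inv_op_closed2[OF s(1) that(1)] by simp
    qed
    show "N = {\<one>} \<or> N = carrier G"
    proof (rule disjCI)
      assume "N \<noteq> carrier G"
      show "N = {\<one>}"
      proof (rule ccontr)
        assume "N \<noteq> {\<one>}"
        then obtain c where c: "c \<in> N" "c \<noteq> \<one>" using N.one_closed by blast
        have "x \<in> N \<and> t \<in> N"
        proof (cases "ord c = 0")
          case True
          then have "t \<in> N" "t \<otimes> x \<in> N" using ord_N[OF c(1)] ord_inf x(1) t by auto
          then have "inv t \<otimes> (t \<otimes> x) \<in> N" by blast
          moreover have "inv t \<otimes> (t \<otimes> x) = x" using x(1) t by (simp add: m_assoc[symmetric])
          ultimately show ?thesis using \<open>t \<in> N\<close> by simp
        next
          case False
          then have "ord c = p" using ord_cases[OF fin _ c(2)] c(1) by auto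
          then have xN: "x \<in> N" using ord_N[OF c(1)] ord_x x(1) by auto
          then have "x \<otimes> (t \<otimes> x \<otimes> inv t) \<in> N" using N.inv_op_closed2[OF t] by blast
          then have "t \<in> N" using ord_N ord_inf t by metis
          then show ?thesis using xN by simp
        qed
        then have "d \<in> N" if "d \<in> carrier G" for d
          using ord_N that ord_cases[OF fin that] ord_x ord_inf(1) N.one_closed by metis
        then show False using \<open>N \<noteq> carrier G\<close> N.subset by blast
      qed
    qed
  qed
qed

theorem theorem3p2:
  fixes p :: nat
  assumes "prime p"
  shows "\<exists>M :: nat monoid.
           is_simple_group M \<and> countable (carrier M) \<and> \<not> comm_group M \<and>
           \<not> torsion_free_group M \<and>
           (\<forall>H. subgroup H M \<longrightarrow> finite H \<longrightarrow> H \<noteq> {\<one>\<^bsub>M\<^esub>} \<longrightarrow>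
              cyclic_group (M\<lparr>carrier := H\<rparr>) \<and> order (M\<lparr>carrier := H\<rparr>) = p)"
proof -
  obtain Z x where Z: "stage p Z" "x \<in> carrier Z" "x \<noteq> \<one>\<^bsub>Z\<^esub>" "x [^]\<^bsub>Z\<^esub> p = \<one>\<^bsub>Z\<^esub>"
    using stage_cyclic[OF assms] by blast
  interpret Z: group Z using Z(1) by (simp add: stage_def)
  obtain G0 t where G0: "stage p G0" "Z \<unlhd>\<^sub>e G0" "t \<in> carrier G0" "t \<otimes>\<^bsub>G0\<^esub> \<one>\<^bsub>Z\<^esub> = \<one>\<^bsub>Z\<^esub> \<otimes>\<^bsub>G0\<^esub> t"
    and t1: "\<forall>g \<in> carrier Z. infinite_order G0 (t \<otimes>\<^bsub>G0\<^esub> g)"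
    and t2: "\<one>\<^bsub>Z\<^esub> = \<one>\<^bsub>Z\<^esub> \<longrightarrow> (\<forall>g \<in> carrier Z - {\<one>\<^bsub>Z\<^esub>}.
      infinite_order G0 (g \<otimes>\<^bsub>G0\<^esub> (t \<otimes>\<^bsub>G0\<^esub> g \<otimes>\<^bsub>G0\<^esub> inv\<^bsub>G0\<^esub> t)))"
    by (rule stage_extension[OF Z(1) Z.one_closed Z.one_closed]) (simp add: equal_order_def)
  \<comment> \<open>Every pair of numbers equals \<open>pair n\<close> for infinitely many \<open>n\<close>. So each pair of elements of the
    union is also treated at a stage that contains both of them.\<close>
  define pair where "pair n = prod_decode (fst (prod_decode n))" for n
  define conj_pair :: "nat \<Rightarrow> nat monoid \<Rightarrow> nat monoid \<Rightarrow> bool" where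
    "conj_pair n G G' \<longleftrightarrow> (\<forall>a b. pair n = (a, b) \<longrightarrow> a \<in> carrier G \<longrightarrow> b \<in> carrier G \<longrightarrow>
       equal_order G a b \<longrightarrow> (\<exists>s \<in> carrier G'. s \<otimes>\<^bsub>G'\<^esub> a = b \<otimes>\<^bsub>G'\<^esub> s))" for n G G'
  have "\<exists>G. \<forall>n. (stage p (G n) \<and> (n = 0 \<longrightarrow> G n = G0)) \<and>
    (G n \<unlhd>\<^sub>e G (Suc n) \<and> conj_pair n (G n) (G (Suc n)))"
  proof (rule dependent_nat_choice)
    show "\<exists>G. stage p G \<and> (0 = (0::nat) \<longrightarrow> G = G0)" using G0(1) by blast
    fix G and n :: nat
    assume "stage p G \<and> (n = 0 \<longrightarrow> G = G0)"
    then have G: "stage p G" by blast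
    obtain a b where ab: "pair n = (a, b)" by fastforce
    have "\<exists>G'. stage p G' \<and> G \<unlhd>\<^sub>e G' \<and> conj_pair n G G'"
    proof (cases "a \<in> carrier G \<and> b \<in> carrier G \<and> equal_order G a b")
      case True
      then have ab': "a \<in> carrier G" "b \<in> carrier G" "equal_order G a b" by simp_all
      show ?thesis
      proof (rule stage_extension[OF G ab'])
        fix G' s assume "stage p G'" "G \<unlhd>\<^sub>e G'" "s \<in> carrier G'" "s \<otimes>\<^bsub>G'\<^esub> a = b \<otimes>\<^bsub>G'\<^esub> s"
        moreover from this have "conj_pair n G G'"
          unfolding conj_pair_def ab by auto
        ultimately show ?thesis by blast
      qed
    next
      case False
      then show ?thesis
        using G unfolding conj_pair_def ab
        by (intro exI[of _ G] conjI) (auto simp: extends_def stage_def)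
    qed
    then show "\<exists>G'. (stage p G' \<and> (Suc n = 0 \<longrightarrow> G' = G0)) \<and> G \<unlhd>\<^sub>e G' \<and> conj_pair n G G'"
      by simp
  qed
  then obtain G where G: "\<And>n. stage p (G n)" "G 0 = G0" "\<And>n. G n \<unlhd>\<^sub>e G (Suc n)"
    "\<And>n. conj_pair n (G n) (G (Suc n))"
    by blast
  interpret C: group_chain G using G(3) by unfold_locales
  interpret M: group C.limit by (rule C.group_limit)
  have fin: "finite_subgroups_order p C.limit"
    unfolding finite_subgroups_order_def
  proof (intro allI impI)
    fix E assume E: "subgroup E C.limit" "finite E"
    then obtain n where "E \<subseteq> carrier (G n)"
      using C.common_stage subgroup.subset by blast
    then have "subgroup E (G n)" using extends_subgroup[OF C.extends_limit E(1)] by blast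
    then show "card E = 1 \<or> card E = p"
      using G(1)[of n] E(2) unfolding stage_def finite_subgroups_order_def by blast
  qed
  have conj: "\<exists>s \<in> carrier C.limit. s \<otimes>\<^bsub>C.limit\<^esub> a = b \<otimes>\<^bsub>C.limit\<^esub> s"
    if ab: "a \<in> carrier C.limit" "b \<in> carrier C.limit" "equal_order C.limit a b" for a b
  proof -
    obtain m where m: "a \<in> carrier (G m)" "b \<in> carrier (G m)"
      using C.common_stage[of "{a, b}"] ab by auto
    define n where "n = prod_encode (prod_encode (a, b), m)"
    have pair: "pair n = (a, b)" by (simp add: pair_def n_def)
    have "m \<le> n" unfolding n_def by (rule le_prod_encode_2)
    then have abn: "a \<in> carrier (G n)" "b \<in> carrier (G n)"
      using m C.carrier_mono by blast+
    then have "equal_order (G n) a b"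
      using ab(3) unfolding equal_order_def C.limit_one[of n]
      by (simp add: extends_pow[OF C.extends_limit[of n]])
    then obtain s where s: "s \<in> carrier (G (Suc n))" "s \<otimes>\<^bsub>G (Suc n)\<^esub> a = b \<otimes>\<^bsub>G (Suc n)\<^esub> s"
      using G(4)[of n] pair abn unfolding conj_pair_def by blast
    moreover have "a \<in> carrier (G (Suc n))" "b \<in> carrier (G (Suc n))"
      using abn C.carrier_mono[of n "Suc n"] by auto
    ultimately show ?thesis
      using C.limit_mult[of _ "Suc n"] C.limit_carrier by (intro bexI[of _ s]) auto
  qed
  have ext: "G0 \<unlhd>\<^sub>e C.limit" using C.extends_limit[of 0] G(2) by simp
  interpret G0: group G0 using G0(1) by (simp add: stage_def)
  have inf: "infinite_order C.limit y" if "infinite_order G0 y" "y \<in> carrier G0" for y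
    using that extends_pow[OF ext] extends_one[OF ext] by (simp add: infinite_order_def)
  have x: "x \<in> carrier G0" using Z(2) G0(2) by (auto simp: extends_def)
  have one: "\<one>\<^bsub>C.limit\<^esub> = \<one>\<^bsub>Z\<^esub>" using extends_one[OF ext] extends_one[OF G0(2)] by simp
  have mult: "y \<otimes>\<^bsub>C.limit\<^esub> z = y \<otimes>\<^bsub>G0\<^esub> z" if "y \<in> carrier G0" "z \<in> carrier G0" for y z
    using that ext by (simp add: extends_def)
  have xM: "x \<in> carrier C.limit" "x \<noteq> \<one>\<^bsub>C.limit\<^esub>" "x [^]\<^bsub>C.limit\<^esub> p = \<one>\<^bsub>C.limit\<^esub>" "t \<in> carrier C.limit"
    using x Z(2-4) G0(2,3) ext extends_pow[OF ext x] extends_pow[OF G0(2) Z(2)]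
    by (auto simp: one extends_def)
  have "infinite_order G0 (t \<otimes>\<^bsub>G0\<^esub> \<one>\<^bsub>Z\<^esub>)" by (rule t1[rule_format, OF Z.one_closed])
  then have "infinite_order C.limit t"
    using inf G0(3) extends_one[OF G0(2)] by (metis G0.r_one)
  moreover have "infinite_order C.limit (t \<otimes>\<^bsub>C.limit\<^esub> x)"
    using inf[OF t1[rule_format, OF Z(2)]] x G0(3) by (simp add: mult)
  moreover have "infinite_order C.limit (x \<otimes>\<^bsub>C.limit\<^esub> (t \<otimes>\<^bsub>C.limit\<^esub> x \<otimes>\<^bsub>C.limit\<^esub> inv\<^bsub>C.limit\<^esub> t))"
    using inf[OF t2[rule_format, OF refl, of x]] Z(2,3) x G0(3) by (simp add: mult extends_inv[OF ext])
  ultimately have "is_simple_group C.limit \<and> \<not> comm_group C.limit \<and> \<not> torsion_free_group C.limit"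
    using M.simple_of_equal_orders_conjugate[OF assms fin conj xM] by simp
  then show ?thesis
    using M.nontrivial_finite_subgroup_cyclic[OF assms fin] by (intro exI[of _ C.limit]) simp
qed

end
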